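(* Let $m\ge n$ be positive integers. The set $\mathcal{M}_{ord}(n,m)$ is a commutative group under the binary operation $M_{\underline t}\circledast M_{\underline{t}'}:=M_{\underline{t}\,\underline{t}'}$, with identity element $M_{(1,\dots,1)}$. In particular, $\mathcal{M}_{ord}(n,m)\cong \mathrm{Pr}_0(n,m)$.
   Context: Let $\mathbb{K}$ be an algebraically closed field of characteristic zero. A semistandard Young tableau of partition shape $\lambda$ is a filling of the Ferrers diagram of $\lambda$ (English notation) with positive integers, strictly increasing down columns and weakly increasing from left to right along rows. For positive integers $m\ge n$, $\mathrm{SSYT}_m^n$ denotes the set of all semistandard Young tableaux of all partition shapes with at most $n$ rows and with entries in $\{1,\dots,m\}$ (including the empty tableau $\emptyset$). For $T$ of shape $\lambda$ and $T'$ of shape $\mu$, $T\star T'$ is the semistandard Young tableau of shape $\lambda+\mu$ obtained by horizontally concatenating the rows of $T$ and $T'$ and sorting the entries in each row in weakly increasing order. $(\mathrm{SSYT}_m^n,\star,\emptyset)$ is a commutative monoid, and the tableaux algebra $\mathcal{T}_{n,m}$ is its monoid algebra over $\mathbb{K}$. Let $G_{n,m}=\{T_1,\dots,T_d\}$ be the set of tableaux in $\mathrm{SSYT}_m^n$ with exactly one column (of height $1,\dots,n$). Write $[a_1,\dots,a_k]$ for the column with entries $a_1<\dots<a_k$ from top to bottom. Set $F_{n,n}=\{[n],\,[1,\dots,n-1],\,[1,\dots,n]\}$ (for $n=1$ this is just $\{[1]\}$), $F_{n,m}=\{[m],\,[1,\dots,n]\}$ if $m\ne n$, and $E_{n,m}=G_{n,m}\setminus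 F_{n,m}$. A product relation is a binomial $T_aT_b-T_cT_e$ with $T_a,T_b,T_c,T_e\in G_{n,m}$ distinct and $T_a\star T_b=T_c\star T_e$; all product relations involve only variables in $E_{n,m}$, and $\mathcal{P}_{n,m}$ is the ideal they generate in the polynomial ring $\mathbb{K}[E_{n,m}]$, with zero locus $\mathcal{V}(\mathcal{P}_{n,m})\subseteq\mathbb{K}^{|E_{n,m}|}$. For $\underline t=(t_i)_{1\le i\le d}\in\mathcal{V}(\mathcal{P}_{n,m})\times\mathbb{K}^{|F_{n,m}|}$ (coordinates indexed by $G_{n,m}$), $M_{\underline t}$ is the maximal ideal of $\mathcal{T}_{n,m}$ generated by all $T_i-t_i$, $1\le i\le d$, and $\pi_{\underline t}:\mathcal{T}_{n,m}\to\mathcal{T}_{n,m}/M_{\underline t}\cong\mathbb{K}$ is the quotient map, $T_i\mapsto t_i$. Let $J(n,m)=\{\underline t\in\mathcal{V}(\mathcal{P}_{n,m})\times\mathbb{K}^{|F_{n,m}|}: t_i\neq0\text{ for all }i\}$ (the ordinary tuples). Then $\mathcal{M}_{ord}(n,m)=\{M_{\underline t}:\underline t\in J(n,m)\}$ and $\mathrm{Pr}_0(n,m)=\{\pi_{\underline t}:\underline t\in J(n,m)\}$, the latter a commutative group under $\pi_{\underline t}\circledast\pi_{\underline s}:=\pi_{\underline t\,\underline s}$. Here $\underline t\,\underline s=(t_is_i)_i$ is the entrywise product. *)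

theory Defs
  imports "HOL-Computational_Algebra.Polynomial" "HOL-Library.Poly_Mapping" "HOL-Algebra.QuotRing"
begin

section \<open>The monoid of semistandard Young tableaux\<close>

text \<open>A tableau is the list of its rows, from top to bottom; there are no empty rows, so the shape
  is a partition and the empty tableau is \<open>[]\<close>. The relation \<open>above r s\<close> says that the row \<open>s\<close> may be
  placed directly below the row \<open>r\<close>.\<close>

definition above :: "nat list \<Rightarrow> nat list \<Rightarrow> bool" where
  "above r s \<longleftrightarrow> length s \<le> length r \<and> (\<forall>j < length s. r ! j < s ! j)"

definition is_ssyt :: "nat list list \<Rightarrow> bool" where
  "is_ssyt T \<longleftrightarrow> (\<forall>r \<in> set T. r \<noteq> [] \<and> sorted r \<and> (\<forall>x \<in> set r. 0 < x)) \<and> successively above T"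

fun star_rows :: "nat list list \<Rightarrow> nat list list \<Rightarrow> nat list list" where
  "star_rows [] U = U"
| "star_rows T [] = T"
| "star_rows (r # T) (s # U) = sort (r @ s) # star_rows T U"

text \<open>To see that \<open>star_rows\<close> preserves semistandardness, \<open>above\<close> is expressed by counting entries.\<close>

lemma sorted_filter_le_count:
  fixes s :: "nat list"
  assumes "sorted s" "j < length s"
  shows "Suc j \<le> length (filter (\<lambda>y. y \<le> s ! j) s)"
proof -
  have "filter (\<lambda>y. y \<le> s ! j) (take (Suc j) s) = take (Suc j) s"
    using assms by (auto simp: filter_id_conv in_set_conv_nth intro!: sorted_nth_mono)
  moreover have "length (filter (\<lambda>y. y \<le> s ! j) s)
      = length (filter (\<lambda>y. y \<le> s ! j) (take (Suc j) s)) + length (filter (\<lambda>y. y \<le> s ! j) (drop (Suc j) s))"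
    by (metis append_take_drop_id filter_append length_append)
  ultimately show ?thesis using assms by simp
qed

lemma sorted_filter_less_count:
  fixes r :: "nat list"
  assumes "sorted r" "Suc j \<le> length (filter (\<lambda>y. y < x) r)"
  shows "j < length r \<and> r ! j < x"
proof -
  have j: "j < length r"
    using assms(2) length_filter_le[of "\<lambda>y. y < x" r] by linarith
  have "r ! j < x"
  proof (rule ccontr)
    assume c: "\<not> r ! j < x"
    have "filter (\<lambda>y. y < x) (drop j r) = []"
    proof -
      have "x \<le> y" if "y \<in> set (drop j r)" for y
      proof -
        obtain i where "i < length r - j" "y = r ! (j + i)"
          using \<open>y \<in> set (drop j r)\<close> by (auto simp: in_set_conv_nth)
        then show ?thesis
          using c sorted_nth_mono[OF assms(1), of j "j + i"] by force
      qed
      then show ?thesis by (auto simp: filter_empty_conv not_less)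
    qed
    then have "length (filter (\<lambda>y. y < x) r) = length (filter (\<lambda>y. y < x) (take j r))"
      by (metis append_Nil2 append_take_drop_id filter_append)
    also have "\<dots> \<le> j"
      using length_filter_le[of "\<lambda>y. y < x" "take j r"] by simp
    finally show False using assms(2) by simp
  qed
  with j show ?thesis by simp
qed

lemma above_iff_count:
  assumes "sorted r" "sorted s"
  shows "above r s \<longleftrightarrow>
    (\<forall>x. length (filter (\<lambda>y. y \<le> x) s) \<le> length (filter (\<lambda>y. y < x) r))"
proof
  assume a: "above r s"
  show "\<forall>x. length (filter (\<lambda>y. y \<le> x) s) \<le> length (filter (\<lambda>y. y < x) r)"
  proof
    fix x
    have "{i. i < length s \<and> s ! i \<le> x} \<subseteq> {i. i < length r \<and> r ! i < x}"
      using a by (fastforce simp: above_def)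
    then show "length (filter (\<lambda>y. y \<le> x) s) \<le> length (filter (\<lambda>y. y < x) r)"
      by (simp add: length_filter_conv_card card_mono)
  qed
next
  assume c: "\<forall>x. length (filter (\<lambda>y. y \<le> x) s) \<le> length (filter (\<lambda>y. y < x) r)"
  have *: "j < length r \<and> r ! j < s ! j" if "j < length s" for j
    using sorted_filter_less_count[OF assms(1)] sorted_filter_le_count[OF assms(2) that] c le_trans
    by blast
  show "above r s"
    unfolding above_def using * by (meson not_less order.irrefl)
qed

lemma length_filter_sort: "length (filter P (sort xs)) = length (filter P xs)"
  by (metis mset_filter mset_sort size_mset)

lemma above_sort_append:
  assumes "sorted r" "sorted s" "sorted r'" "sorted s'" "above r s" "above r' s'"
  shows "above (sort (r @ r')) (sort (s @ s'))"
  using assms by (simp add: above_iff_count length_filter_sort add_mono)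

definition first_row :: "nat list list \<Rightarrow> nat list" where
  "first_row T = (case T of [] \<Rightarrow> [] | r # _ \<Rightarrow> r)"

lemma is_ssyt_Nil: "is_ssyt []"
  by (simp add: is_ssyt_def)

lemma is_ssyt_Cons:
  "is_ssyt (r # T) \<longleftrightarrow>
    r \<noteq> [] \<and> sorted r \<and> (\<forall>x \<in> set r. 0 < x) \<and> above r (first_row T) \<and> is_ssyt T"
  by (cases T) (auto simp: is_ssyt_def first_row_def above_def)

lemma sorted_first_row: "is_ssyt T \<Longrightarrow> sorted (first_row T)"
  by (cases T) (auto simp: is_ssyt_def first_row_def)

lemma first_row_star_rows:
  "is_ssyt T \<Longrightarrow> is_ssyt U \<Longrightarrow> first_row (star_rows T U) = sort (first_row T @ first_row U)"
  by (cases T; cases U) (auto simp: first_row_def is_ssyt_def sorted_sort_id)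

lemma is_ssyt_star_rows: "is_ssyt T \<Longrightarrow> is_ssyt U \<Longrightarrow> is_ssyt (star_rows T U)"
proof (induction T U rule: star_rows.induct)
  case (3 r T s U)
  then have "above (sort (r @ s)) (sort (first_row T @ first_row U))"
    by (intro above_sort_append) (auto simp: is_ssyt_Cons sorted_first_row)
  moreover have "sort (r @ s) \<noteq> []"
    using 3 by (metis append_is_Nil_conv is_ssyt_Cons length_0_conv length_sort)
  ultimately show ?case
    using 3 by (auto simp: is_ssyt_Cons first_row_star_rows)
qed auto

lemma star_rows_commute: "star_rows T U = star_rows U T"
proof (induction T U rule: star_rows.induct)
  case (1 U)
  then show ?case by (cases U) auto
next
  case (3 r T s U)
  then show ?case by (auto intro!: properties_for_sort)
qed auto

lemma star_rows_assoc: "star_rows (star_rows T U) V = star_rows T (star_rows U V)"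
proof (induction T U arbitrary: V rule: star_rows.induct)
  case (3 r T s U)
  then show ?case by (cases V) (auto intro!: properties_for_sort)
next
  case (2 r T)
  then show ?case by (cases V) auto
qed auto

typedef ssyt = "{T. is_ssyt T}"
  morphisms rows Tableau
  using is_ssyt_Nil by blast

setup_lifting type_definition_ssyt

text \<open>The monoid \<open>(SSYT, \<star>, \<emptyset>)\<close> is written additively, \<open>T + T'\<close> for \<open>T \<star> T'\<close> and \<open>0\<close> for the empty
  tableau, as required by the convolution product on \<^typ>\<open>'a \<Rightarrow>\<^sub>0 'b\<close>.\<close>

instantiation ssyt :: comm_monoid_add
begin

lift_definition zero_ssyt :: ssyt is "[]"
  by (rule is_ssyt_Nil)

lift_definition plus_ssyt :: "ssyt \<Rightarrow> ssyt \<Rightarrow> ssyt" is star_rows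
  by (rule is_ssyt_star_rows)

instance
proof
  fix a b c :: ssyt
  show "a + b + c = a + (b + c)"
    by transfer (rule star_rows_assoc)
  show "a + b = b + a"
    by transfer (rule star_rows_commute)
  show "0 + a = a"
    by transfer simp
qed

end

definition SSYT :: "nat \<Rightarrow> nat \<Rightarrow> ssyt set" where
  "SSYT n m = {T. length (rows T) \<le> n \<and> (\<forall>r \<in> set (rows T). set r \<subseteq> {1..m})}"

text \<open>\<open>column [a\<^sub>1, \<dots>, a\<^sub>k]\<close> is a tableau only if \<open>0 < a\<^sub>1 < \<dots> < a\<^sub>k\<close>.\<close>

definition column :: "nat list \<Rightarrow> ssyt" where
  "column as = Tableau (map (\<lambda>a. [a]) as)"

definition G_set :: "nat \<Rightarrow> nat \<Rightarrow> ssyt set" where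
  "G_set n m = {T \<in> SSYT n m. rows T \<noteq> [] \<and> (\<forall>r \<in> set (rows T). length r = 1)}"

definition F_set :: "nat \<Rightarrow> nat \<Rightarrow> ssyt set" where
  "F_set n m =
    (if m \<noteq> n then {column [m], column [1..<Suc n]}
     else if n = 1 then {column [1]}
     else {column [n], column [1..<n], column [1..<Suc n]})"

definition E_set :: "nat \<Rightarrow> nat \<Rightarrow> ssyt set" where
  "E_set n m = G_set n m - F_set n m"


section \<open>Monoid algebras and the variety of product relations\<close>

text \<open>The monoid algebra of a submonoid \<open>A\<close>, inside that of the whole type; the product is
  convolution.\<close>

definition monoid_algebra :: "'a set \<Rightarrow> ('a::comm_monoid_add \<Rightarrow>\<^sub>0 'k::field) ring" where
  "monoid_algebra A = \<lparr>carrier = {f. Poly_Mapping.keys f \<subseteq> A}, mult = (*), one = 1, zero = 0, add = (+)\<rparr>"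

definition tableaux_algebra :: "nat \<Rightarrow> nat \<Rightarrow> (ssyt \<Rightarrow>\<^sub>0 'k::field) ring" where
  "tableaux_algebra n m = monoid_algebra (SSYT n m)"

text \<open>A monomial in variables indexed by \<open>'v\<close> is its exponent vector, an element of \<^typ>\<open>'v \<Rightarrow>\<^sub>0 nat\<close>,
  so the polynomial ring \<open>K[A]\<close> is the monoid algebra of the exponent vectors supported in \<open>A\<close>.\<close>

definition poly_ring :: "'v set \<Rightarrow> (('v \<Rightarrow>\<^sub>0 nat) \<Rightarrow>\<^sub>0 'k::field) ring" where
  "poly_ring A = monoid_algebra {e. Poly_Mapping.keys e \<subseteq> A}"

definition poly_var :: "'v \<Rightarrow> ('v \<Rightarrow>\<^sub>0 nat) \<Rightarrow>\<^sub>0 'k::field" where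
  "poly_var v = Poly_Mapping.single (Poly_Mapping.single v 1) 1"

definition poly_eval :: "('v \<Rightarrow> 'k::field) \<Rightarrow> (('v \<Rightarrow>\<^sub>0 nat) \<Rightarrow>\<^sub>0 'k) \<Rightarrow> 'k" where
  "poly_eval x p = (\<Sum>e \<in> Poly_Mapping.keys p. Poly_Mapping.lookup p e * (\<Prod>v \<in> Poly_Mapping.keys e. x v ^ Poly_Mapping.lookup e v))"

definition zero_locus :: "'v set \<Rightarrow> (('v \<Rightarrow>\<^sub>0 nat) \<Rightarrow>\<^sub>0 'k::field) set \<Rightarrow> ('v \<Rightarrow> 'k) set" where
  "zero_locus A I = {x \<in> A \<rightarrow>\<^sub>E UNIV. \<forall>p \<in> I. poly_eval x p = 0}"

definition product_relations :: "nat \<Rightarrow> nat \<Rightarrow> ((ssyt \<Rightarrow>\<^sub>0 nat) \<Rightarrow>\<^sub>0 'k::field) set" where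
  "product_relations n m =
    {poly_var a * poly_var b - poly_var c * poly_var e | a b c e.
       {a, b, c, e} \<subseteq> G_set n m \<and> distinct [a, b, c, e] \<and> a + b = c + e}"

text \<open>Product relations involve no variable in \<open>F_set\<close>, so they do lie in \<open>K[E]\<close>, as \<open>genideal\<close>
  presupposes.\<close>

definition P_ideal :: "nat \<Rightarrow> nat \<Rightarrow> ((ssyt \<Rightarrow>\<^sub>0 nat) \<Rightarrow>\<^sub>0 'k::field) set" where
  "P_ideal n m = genideal (poly_ring (E_set n m)) (product_relations n m)"


section \<open>Ordinary tuples, maximal ideals and projections\<close>

text \<open>Points of \<open>V(P) \<times> K\<^bsup>|F|\<^esup>\<close>, as families indexed by the disjoint union of \<open>E_set\<close> and
  \<open>F_set\<close>, that is, by \<open>G_set\<close>.\<close>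

definition tuples :: "nat \<Rightarrow> nat \<Rightarrow> (ssyt \<Rightarrow> 'k::field) set" where
  "tuples n m =
    {t \<in> G_set n m \<rightarrow>\<^sub>E UNIV. restrict t (E_set n m) \<in> zero_locus (E_set n m) (P_ideal n m)}"

definition ordinary_tuples :: "nat \<Rightarrow> nat \<Rightarrow> (ssyt \<Rightarrow> 'k::field) set" where
  "ordinary_tuples n m = {t \<in> tuples n m. \<forall>T \<in> G_set n m. t T \<noteq> 0}"

definition tuple_mult :: "nat \<Rightarrow> nat \<Rightarrow> (ssyt \<Rightarrow> 'k::field) \<Rightarrow> (ssyt \<Rightarrow> 'k) \<Rightarrow> ssyt \<Rightarrow> 'k" where
  "tuple_mult n m t s = (\<lambda>T \<in> G_set n m. t T * s T)"

definition tuple_one :: "nat \<Rightarrow> nat \<Rightarrow> ssyt \<Rightarrow> 'k::field" where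
  "tuple_one n m = (\<lambda>T \<in> G_set n m. 1)"

text \<open>The scalar \<open>c\<close> of a monoid algebra is \<open>Poly_Mapping.single 0 c\<close>, with \<open>0\<close> the neutral element of
  the monoid.\<close>

definition max_ideal :: "nat \<Rightarrow> nat \<Rightarrow> (ssyt \<Rightarrow> 'k::field) \<Rightarrow> (ssyt \<Rightarrow>\<^sub>0 'k) set" where
  "max_ideal n m t = genideal (tableaux_algebra n m)
    {Poly_Mapping.single T 1 - Poly_Mapping.single 0 (t T) | T. T \<in> G_set n m}"

text \<open>The quotient map modulo \<open>max_ideal n m t\<close> followed by the inverse of the isomorphism from \<open>K\<close>
  to the quotient that sends \<open>c\<close> to the coset of the scalar \<open>c\<close>.\<close>

definition projection :: "nat \<Rightarrow> nat \<Rightarrow> (ssyt \<Rightarrow> 'k::field) \<Rightarrow> (ssyt \<Rightarrow>\<^sub>0 'k) \<Rightarrow> 'k" where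
  "projection n m t = (\<lambda>f \<in> carrier (tableaux_algebra n m).
    inv_into UNIV (\<lambda>c. max_ideal n m t +>\<^bsub>tableaux_algebra n m\<^esub> Poly_Mapping.single 0 c)
      (max_ideal n m t +>\<^bsub>tableaux_algebra n m\<^esub> f))"

definition M_ord :: "nat \<Rightarrow> nat \<Rightarrow> (ssyt \<Rightarrow>\<^sub>0 'k::field) set set" where
  "M_ord n m = max_ideal n m ` ordinary_tuples n m"

definition Pr_0 :: "nat \<Rightarrow> nat \<Rightarrow> ((ssyt \<Rightarrow>\<^sub>0 'k::field) \<Rightarrow> 'k) set" where
  "Pr_0 n m = projection n m ` ordinary_tuples n m"

text \<open>The operation \<open>\<Phi> t \<circledast> \<Phi> s := \<Phi> (t s)\<close> for a family \<open>\<Phi>\<close> indexed by the ordinary tuples. The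
  description is meaningful only if the value is independent of the chosen \<open>t\<close> and \<open>s\<close>.\<close>

definition induced_mult ::
    "nat \<Rightarrow> nat \<Rightarrow> ((ssyt \<Rightarrow> 'k::field) \<Rightarrow> 'b) \<Rightarrow> 'b \<Rightarrow> 'b \<Rightarrow> 'b" where
  "induced_mult n m \<Phi> x y =
    (THE z. \<exists>t \<in> ordinary_tuples n m. \<exists>s \<in> ordinary_tuples n m.
       x = \<Phi> t \<and> y = \<Phi> s \<and> z = \<Phi> (tuple_mult n m t s))"

definition M_ord_group :: "nat \<Rightarrow> nat \<Rightarrow> (ssyt \<Rightarrow>\<^sub>0 'k::field) set monoid" where
  "M_ord_group n m =
    \<lparr>carrier = M_ord n m, mult = induced_mult n m (max_ideal n m),
     one = max_ideal n m (tuple_one n m)\<rparr>"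

definition Pr_0_group :: "nat \<Rightarrow> nat \<Rightarrow> ((ssyt \<Rightarrow>\<^sub>0 'k::field) \<Rightarrow> 'k) monoid" where
  "Pr_0_group n m =
    \<lparr>carrier = Pr_0 n m, mult = induced_mult n m (projection n m),
     one = projection n m (tuple_one n m)\<rparr>"

end

theory Submission
  imports Defs
begin

text \<open>
  Ordinary tuples form a group under entrywise multiplication: they are the nowhere vanishing solutions
  of the binomial equations \<open>t a * t b = t c * t e\<close>, one for each relation \<open>a + b = c + e\<close> between columns
  (\<open>tuples_iff\<close>). The operations on the ideals \<open>max_ideal n m t\<close> and on the projections are transported from
  this group, so everything follows once \<open>t\<close> is shown to be determined by its ideal and by its
  projection: both sets are then isomorphic copies of the group of ordinary tuples.

  Recovering \<open>t\<close> from \<open>max_ideal n m t\<close> amounts to the existence of a homomorphism from the tableaux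
  algebra to \<open>K\<close> with \<open>T \<mapsto> t T\<close> for each column \<open>T\<close>. Every tableau is a sum of columns, so its value must be
  the product of their values, and the content is that this product does not depend on the decomposition:
  all relations between columns follow from the quadratic ones.

  To see this, a tableau is encoded by the function that counts, for all \<open>i\<close> and \<open>x\<close>, the entries of row
  \<open>i\<close> that are at most \<open>x\<close>. This encoding is injective and additive (\<open>count_le_inject\<close>, \<open>count_le_plus\<close>).
  Columns become the indicator functions of certain sets that are closed under union and intersection, and
  \<open>1\<^sub>A + 1\<^sub>B = 1\<^bsub>A\<union>B\<^esub> + 1\<^bsub>A\<inter>B\<^esub>\<close>. By relations of this kind any nonempty family of columns can be changed so
  that one member is the union of all (\<open>extract_first_column\<close>). That member depends on the sum of the family
  only, hence it cancels from any two decompositions of the same tableau, and induction on the number of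
  columns finishes the argument (\<open>column_product_cong\<close>).

  The definition of the variety is stated with polynomials in the variables \<open>E_set\<close>; that the columns in
  \<open>F_set\<close> do not occur in product relations is \<open>product_relation_in_E_set\<close>.
\<close>

section \<open>Characters of a monoid and its monoid algebra\<close>

text \<open>The \<open>K\<close>-linear map out of the monoid algebra with \<open>a \<mapsto> \<chi> a\<close>. Both the evaluation of polynomials at a
  point and the evaluation of the tableaux algebra at a tuple are of this form.\<close>

definition lin_ext :: "('a \<Rightarrow> 'k) \<Rightarrow> ('a::comm_monoid_add \<Rightarrow>\<^sub>0 'k::field) \<Rightarrow> 'k" where
  "lin_ext \<chi> f = (\<Sum>a \<in> Poly_Mapping.keys f. Poly_Mapping.lookup f a * \<chi> a)"

lemma lin_ext_superset:
  assumes "finite S" "Poly_Mapping.keys f \<subseteq> S"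
  shows "lin_ext \<chi> f = (\<Sum>a \<in> S. Poly_Mapping.lookup f a * \<chi> a)"
  unfolding lin_ext_def using assms by (intro sum.mono_neutral_left) (auto simp: in_keys_iff)

lemma lin_ext_zero [simp]: "lin_ext \<chi> 0 = 0"
  by (simp add: lin_ext_def)

lemma lin_ext_single [simp]: "lin_ext \<chi> (Poly_Mapping.single a c) = c * \<chi> a"
  by (simp add: lin_ext_def)

lemma lin_ext_add: "lin_ext \<chi> (f + g) = lin_ext \<chi> f + lin_ext \<chi> g"
proof -
  let ?S = "Poly_Mapping.keys f \<union> Poly_Mapping.keys g"
  have "lin_ext \<chi> h = (\<Sum>a \<in> ?S. Poly_Mapping.lookup h a * \<chi> a)"
    if "Poly_Mapping.keys h \<subseteq> ?S" for h
    using that by (intro lin_ext_superset) auto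
  then show ?thesis
    by (simp add: keys_add lookup_add distrib_right sum.distrib)
qed

lemma lin_ext_uminus: "lin_ext \<chi> (- f) = - lin_ext \<chi> f"
  by (simp add: lin_ext_def sum_negf)

lemma lin_ext_diff: "lin_ext \<chi> (f - g) = lin_ext \<chi> f - lin_ext \<chi> g"
  using lin_ext_add[of \<chi> f "- g"] by (simp add: lin_ext_uminus)

lemma lin_ext_sum: "lin_ext \<chi> (\<Sum>i \<in> I. f i) = (\<Sum>i \<in> I. lin_ext \<chi> (f i))"
  by (induction I rule: infinite_finite_induct) (auto simp: lin_ext_add)

lemma sum_of_monomials:
  "(\<Sum>a \<in> Poly_Mapping.keys f. Poly_Mapping.single a (Poly_Mapping.lookup f a)) = f"
  by (rule poly_mapping_eqI) (auto simp: lookup_sum lookup_single when_def in_keys_iff)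

lemma lin_ext_mult:
  assumes "\<And>a b. a \<in> A \<Longrightarrow> b \<in> A \<Longrightarrow> \<chi> (a + b) = \<chi> a * \<chi> b"
    and "Poly_Mapping.keys f \<subseteq> A" "Poly_Mapping.keys g \<subseteq> A"
  shows "lin_ext \<chi> (f * g) = lin_ext \<chi> f * lin_ext \<chi> g"
proof -
  let ?mon = "\<lambda>h a. Poly_Mapping.single a (Poly_Mapping.lookup h a)"
  have "f * g = (\<Sum>a \<in> Poly_Mapping.keys f. ?mon f a) * (\<Sum>b \<in> Poly_Mapping.keys g. ?mon g b)"
    by (simp only: sum_of_monomials)
  also have "\<dots> = (\<Sum>a \<in> Poly_Mapping.keys f. \<Sum>b \<in> Poly_Mapping.keys g.
      Poly_Mapping.single (a + b) (Poly_Mapping.lookup f a * Poly_Mapping.lookup g b))"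
    by (simp add: sum_product mult_single)
  finally have "lin_ext \<chi> (f * g) = (\<Sum>a \<in> Poly_Mapping.keys f. \<Sum>b \<in> Poly_Mapping.keys g.
      Poly_Mapping.lookup f a * Poly_Mapping.lookup g b * \<chi> (a + b))"
    by (simp add: lin_ext_sum)
  also have "\<dots> = (\<Sum>a \<in> Poly_Mapping.keys f. \<Sum>b \<in> Poly_Mapping.keys g.
      (Poly_Mapping.lookup f a * \<chi> a) * (Poly_Mapping.lookup g b * \<chi> b))"
    using assms by (intro sum.cong refl) (simp add: subset_iff algebra_simps)
  finally show ?thesis
    by (simp add: lin_ext_def sum_product)
qed

lemma cring_monoid_algebra:
  assumes "0 \<in> A" "\<And>a b. a \<in> A \<Longrightarrow> b \<in> A \<Longrightarrow> a + b \<in> A"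
  shows "cring (monoid_algebra A :: ('a::comm_monoid_add \<Rightarrow>\<^sub>0 'k::field) ring)"
proof (rule cringI)
  let ?R = "monoid_algebra A :: ('a \<Rightarrow>\<^sub>0 'k) ring"
  show "abelian_group ?R"
  proof (rule abelian_groupI)
    fix f assume "f \<in> carrier ?R"
    then show "\<exists>g \<in> carrier ?R. g \<oplus>\<^bsub>?R\<^esub> f = \<zero>\<^bsub>?R\<^esub>"
      by (intro bexI[of _ "- f"]) (auto simp: monoid_algebra_def)
  qed (use keys_add in \<open>fastforce simp: monoid_algebra_def algebra_simps\<close>)+
  show "Group.comm_monoid ?R"
  proof (rule comm_monoidI)
    fix f g assume "f \<in> carrier ?R" "g \<in> carrier ?R"
    then show "f \<otimes>\<^bsub>?R\<^esub> g \<in> carrier ?R"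
      using keys_mult[of f g] assms(2) by (fastforce simp: monoid_algebra_def)
  qed (use assms in \<open>auto simp: monoid_algebra_def algebra_simps\<close>)
qed (auto simp: monoid_algebra_def algebra_simps)

lemma minus_monoid_algebra:
  assumes "0 \<in> A" "\<And>a b. a \<in> A \<Longrightarrow> b \<in> A \<Longrightarrow> a + b \<in> A"
    and "f \<in> carrier (monoid_algebra A)"
  shows "\<ominus>\<^bsub>monoid_algebra A\<^esub> f = (- f :: 'a::comm_monoid_add \<Rightarrow>\<^sub>0 'k::field)"
proof -
  interpret cring "monoid_algebra A :: ('a \<Rightarrow>\<^sub>0 'k) ring"
    using assms by (intro cring_monoid_algebra)
  show ?thesis
    using assms(3) by (intro minus_equality) (auto simp: monoid_algebra_def)
qed

text \<open>If \<open>\<chi>\<close> is multiplicative on \<open>A\<close>, then the kernel of its linear extension is an ideal, so the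
  extension vanishes on an ideal as soon as it vanishes on generators.\<close>

lemma genideal_in_kernel:
  fixes \<chi> :: "'a::comm_monoid_add \<Rightarrow> 'k::field"
  assumes zero: "0 \<in> A" and plus: "\<And>a b. a \<in> A \<Longrightarrow> b \<in> A \<Longrightarrow> a + b \<in> A"
    and \<chi>: "\<And>a b. a \<in> A \<Longrightarrow> b \<in> A \<Longrightarrow> \<chi> (a + b) = \<chi> a * \<chi> b"
    and S: "S \<subseteq> carrier (monoid_algebra A)" "\<And>f. f \<in> S \<Longrightarrow> lin_ext \<chi> f = 0"
    and f: "f \<in> genideal (monoid_algebra A) S"
  shows "lin_ext \<chi> f = 0"
proof -
  let ?R = "monoid_algebra A :: ('a \<Rightarrow>\<^sub>0 'k) ring"
  let ?I = "{f \<in> carrier ?R. lin_ext \<chi> f = 0}"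
  interpret cring ?R
    using zero plus by (rule cring_monoid_algebra)
  have mult: "lin_ext \<chi> (g \<otimes>\<^bsub>?R\<^esub> h) = lin_ext \<chi> g * lin_ext \<chi> h"
    if "g \<in> carrier ?R" "h \<in> carrier ?R" for g h
    using that lin_ext_mult[of A \<chi> g h] \<chi> by (simp add: monoid_algebra_def)
  have add: "lin_ext \<chi> (g \<oplus>\<^bsub>?R\<^esub> h) = lin_ext \<chi> g + lin_ext \<chi> h" for g h
    by (simp add: monoid_algebra_def lin_ext_add)
  have zero': "lin_ext \<chi> \<zero>\<^bsub>?R\<^esub> = 0"
    by (simp add: monoid_algebra_def)
  have "ideal ?I ?R"
  proof (rule idealI)
    show "ring ?R"
      by (rule ring_axioms)
    show "subgroup ?I (add_monoid ?R)"
    proof (rule add.subgroupI)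
      show "?I \<noteq> {}"
        using zero' by blast
      show "\<ominus>\<^bsub>?R\<^esub> g \<in> ?I" if "g \<in> ?I" for g
        using that a_inv_closed[of g] minus_monoid_algebra[OF zero plus, of g]
        by (simp add: lin_ext_uminus)
    qed (auto simp: add)
  qed (auto simp: mult)
  with S have "genideal ?R S \<subseteq> ?I"
    by (intro genideal_minimal) auto
  with f show ?thesis
    by blast
qed

definition monomial_value :: "('v \<Rightarrow> 'k::field) \<Rightarrow> ('v \<Rightarrow>\<^sub>0 nat) \<Rightarrow> 'k" where
  "monomial_value x e = (\<Prod>v \<in> Poly_Mapping.keys e. x v ^ Poly_Mapping.lookup e v)"

lemma poly_eval_eq_lin_ext: "poly_eval x = lin_ext (monomial_value x)"
  by (simp add: fun_eq_iff poly_eval_def lin_ext_def monomial_value_def)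

lemma monomial_value_add:
  "monomial_value x (d + e) = monomial_value x d * monomial_value x e"
proof -
  let ?S = "Poly_Mapping.keys d \<union> Poly_Mapping.keys e"
  have "monomial_value x c = (\<Prod>v \<in> ?S. x v ^ Poly_Mapping.lookup c v)"
    if "Poly_Mapping.keys c \<subseteq> ?S" for c
    unfolding monomial_value_def using that
    by (intro prod.mono_neutral_left) (auto simp: in_keys_iff)
  then show ?thesis
    by (simp add: keys_add lookup_add power_add prod.distrib)
qed

lemma poly_eval_binomial:
  "poly_eval x (poly_var a * poly_var b - poly_var c * poly_var e) = x a * x b - x c * x e"
  by (simp add: poly_eval_eq_lin_ext poly_var_def lin_ext_diff mult_single monomial_value_add)
     (simp add: monomial_value_def)

lemma keys_poly_var_mult:
  assumes "a \<in> A" "b \<in> A"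
  shows "Poly_Mapping.keys (poly_var a * poly_var b :: ('v \<Rightarrow>\<^sub>0 nat) \<Rightarrow>\<^sub>0 'k::field)
     \<subseteq> {e. Poly_Mapping.keys e \<subseteq> A}"
  using assms keys_add[of "Poly_Mapping.single a (1::nat)" "Poly_Mapping.single b 1"]
  by (auto simp: poly_var_def mult_single)


section \<open>Tableaux as counting functions\<close>

text \<open>The monoid operation merges and sorts rows, which is awkward to compute with. Counting the entries
  of row \<open>i\<close> that are at most \<open>x\<close> turns it into the pointwise addition of functions on \<open>\<nat> \<times> \<nat>\<close>, and a
  tableau can be recovered from its counts. So the tableaux form a submonoid of \<open>\<nat>\<^bsup>\<nat>\<times>\<nat>\<^esup>\<close>; in particular
  they are cancellative.\<close>

definition count_le :: "ssyt \<Rightarrow> nat \<Rightarrow> nat \<Rightarrow> nat" where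
  "count_le T i x =
    (if i < length (rows T) then length (filter (\<lambda>y. y \<le> x) (rows T ! i)) else 0)"

lemma count_le_zero [simp]: "count_le 0 i x = 0"
  by (simp add: count_le_def zero_ssyt.rep_eq)

lemma count_le_plus: "count_le (T + U) i x = count_le T i x + count_le U i x"
proof -
  have "(if i < length (star_rows R S) then length (filter (\<lambda>y. y \<le> x) (star_rows R S ! i)) else 0)
      = (if i < length R then length (filter (\<lambda>y. y \<le> x) (R ! i)) else 0)
      + (if i < length S then length (filter (\<lambda>y. y \<le> x) (S ! i)) else 0)" for R S
  proof (induction R S arbitrary: i rule: star_rows.induct)
    case (3 r T s U)
    show ?case
    proof (cases i)
      case (Suc k)
      then show ?thesis
        using "3.IH"[of k] unfolding Suc by (simp cong: if_cong split del: if_split)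
    qed (simp add: length_filter_sort)
  qed auto
  then show ?thesis
    unfolding count_le_def plus_ssyt.rep_eq .
qed

lemma count_le_sum: "count_le (\<Sum>j \<in> J. f j) i x = (\<Sum>j \<in> J. count_le (f j) i x)"
  by (induction J rule: infinite_finite_induct) (auto simp: count_le_plus)

lemma is_ssyt_rows [simp]: "is_ssyt (rows T)"
  using rows[of T] by simp

lemma row_props:
  assumes "i < length (rows T)"
  shows "rows T ! i \<noteq> []" "sorted (rows T ! i)" "\<And>x. x \<in> set (rows T ! i) \<Longrightarrow> 0 < x"
  using is_ssyt_rows[of T] nth_mem[OF assms] unfolding is_ssyt_def by blast+

lemma length_filter_le_Suc:
  "length (filter (\<lambda>y. y \<le> Suc x) r) = length (filter (\<lambda>y. y \<le> x) r) + count (mset r) (Suc x)"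
  by (induction r) auto

lemma length_filter_le_0: "length (filter (\<lambda>y. y \<le> (0::nat)) r) = count (mset r) 0"
  by (induction r) auto

lemma count_le_inject:
  assumes "\<And>i x. count_le T i x = count_le U i x"
  shows "T = U"
proof -
  have pos: "i < length (rows V) \<longleftrightarrow> (\<exists>x. 0 < count_le V i x)" for V i
  proof
    assume i: "i < length (rows V)"
    then have "rows V ! i \<noteq> []"
      by (rule row_props)
    then have "hd (rows V ! i) \<in> set (filter (\<lambda>y. y \<le> hd (rows V ! i)) (rows V ! i))"
      by simp
    then have "0 < count_le V i (hd (rows V ! i))"
      using i length_pos_if_in_set by (fastforce simp: count_le_def)
    then show "\<exists>x. 0 < count_le V i x" ..
  qed (auto simp: count_le_def split: if_splits)
  have "length (rows T) = length (rows U)"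
    using pos[of _ T] pos[of _ U] assms by (metis nat_neq_iff)
  moreover have "rows T ! i = rows U ! i" if i: "i < length (rows T)" "i < length (rows U)" for i
  proof -
    have *: "length (filter (\<lambda>y. y \<le> x) (rows T ! i)) = length (filter (\<lambda>y. y \<le> x) (rows U ! i))" for x
      using assms[of i x] i by (simp add: count_le_def)
    \<comment> \<open>The multiplicity of an entry is a difference of two consecutive counts, and a sorted row is
      determined by its multiplicities.\<close>
    have "count (mset (rows T ! i)) x = count (mset (rows U ! i)) x" for x
    proof (cases x)
      case 0
      then show ?thesis
        using *[of 0] by (simp only: length_filter_le_0)
    next
      case (Suc y)
      then show ?thesis
        using *[of x] *[of y] by (simp only: length_filter_le_Suc)
    qed
    then have "mset (rows T ! i) = mset (rows U ! i)"
      by (rule multiset_eqI)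
    then show ?thesis
      using i row_props(2) by (metis properties_for_sort sorted_sort_id)
  qed
  ultimately have "rows T = rows U"
    by (auto intro: nth_equalityI)
  then show ?thesis
    by (simp add: rows_inject)
qed

lemma ssyt_add_left_cancel: "(c::ssyt) + T = c + U \<Longrightarrow> T = U"
  by (rule count_le_inject) (metis add_left_cancel count_le_plus)

lemma count_le_mono: "x \<le> y \<Longrightarrow> count_le T i x \<le> count_le T i y"
proof -
  assume "x \<le> y"
  then have "length (filter (\<lambda>z. z \<le> x) r) \<le> length (filter (\<lambda>z. z \<le> y) r)" for r
    by (induction r) auto
  then show ?thesis
    by (simp add: count_le_def)
qed

lemma count_le_at_0 [simp]: "count_le T i 0 = 0"
  using row_props(3)[of i T] by (auto simp: count_le_def filter_empty_conv)

text \<open>This is the strict increase down the columns, expressed by counts.\<close>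

lemma count_le_Suc_Suc: "count_le T (Suc i) (Suc x) \<le> count_le T i x"
proof (cases "Suc i < length (rows T)")
  case True
  then have "above (rows T ! i) (rows T ! Suc i)"
    using is_ssyt_rows[of T] successively_nth unfolding is_ssyt_def by blast
  then have "length (filter (\<lambda>y. y \<le> Suc x) (rows T ! Suc i))
      \<le> length (filter (\<lambda>y. y < Suc x) (rows T ! i))"
    using above_iff_count[of "rows T ! i" "rows T ! Suc i"] row_props(2) True by simp
  then show ?thesis
    using True by (simp add: count_le_def less_Suc_eq_le)
qed (simp add: count_le_def)

lemma count_le_Suc_row: "count_le T (Suc i) x \<le> count_le T i x"
proof (cases x)
  case (Suc y)
  then show ?thesis
    using count_le_Suc_Suc[of T i y] count_le_mono[of y x T i] by simp
qed simp

lemma count_le_le_row_0: "count_le T i x \<le> count_le T 0 x"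
  by (induction i) (use count_le_Suc_row le_trans in blast)+

lemma SSYT_zero: "0 \<in> SSYT n m"
  by (simp add: SSYT_def zero_ssyt.rep_eq)

lemma SSYT_plus:
  assumes "T \<in> SSYT n m" "U \<in> SSYT n m"
  shows "T + U \<in> SSYT n m"
proof -
  have "length (star_rows R S) = max (length R) (length S)" for R S
    by (induction R S rule: star_rows.induct) auto
  moreover have "\<Union> (set ` set (star_rows R S)) = \<Union> (set ` set R) \<union> \<Union> (set ` set S)" for R S
    by (induction R S rule: star_rows.induct) auto
  moreover have "\<Union> (set ` set (rows T)) \<subseteq> {1..m}" "\<Union> (set ` set (rows U)) \<subseteq> {1..m}"
    using assms unfolding SSYT_def by blast+
  ultimately have "\<Union> (set ` set (rows (T + U))) \<subseteq> {1..m}"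
      "length (rows (T + U)) = max (length (rows T)) (length (rows U))"
    by (simp_all add: plus_ssyt.rep_eq)
  then show ?thesis
    using assms unfolding SSYT_def by auto
qed

lemma count_le_SSYT:
  assumes "T \<in> SSYT n m"
  shows "count_le T i x \<le> count_le T i m" "0 < count_le T i x \<Longrightarrow> i < n"
proof -
  have "filter (\<lambda>y. y \<le> m) r = r" if "r \<in> set (rows T)" for r
    using assms that by (force simp: SSYT_def filter_id_conv)
  then show "count_le T i x \<le> count_le T i m"
    by (simp add: count_le_def)
  show "0 < count_le T i x \<Longrightarrow> i < n"
    using assms by (auto simp: SSYT_def count_le_def split: if_splits)
qed


section \<open>The distributive lattice of columns\<close>

text \<open>The counts of a column are \<open>0\<close> or \<open>1\<close>, so a column is the same as its region. For a general tableau,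
  the region is that of its first column.\<close>

definition region :: "ssyt \<Rightarrow> (nat \<times> nat) set" where
  "region T = {(i, x). 0 < count_le T i x}"

text \<open>These conditions, preserved by unions and intersections, characterise the regions of columns with
  at most \<open>n\<close> entries in \<open>{1..m}\<close>; see \<open>region_in_column_regions\<close> and \<open>column_with_region\<close>.\<close>

definition column_regions :: "nat \<Rightarrow> nat \<Rightarrow> (nat \<times> nat) set set" where
  "column_regions n m = {D. (0, m) \<in> D
     \<and> (\<forall>i x. (i, x) \<in> D \<longrightarrow> i < n \<and> 0 < x \<and> (i, m) \<in> D \<and> (\<forall>y \<ge> x. (i, y) \<in> D))
     \<and> (\<forall>i x. (Suc i, Suc x) \<in> D \<longrightarrow> (i, x) \<in> D)}"

lemma column_regions_Un:
  "D \<in> column_regions n m \<Longrightarrow> D' \<in> column_regions n m \<Longrightarrow> D \<union> D' \<in> column_regions n m"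
  unfolding column_regions_def by blast

lemma column_regions_Int:
  "D \<in> column_regions n m \<Longrightarrow> D' \<in> column_regions n m \<Longrightarrow> D \<inter> D' \<in> column_regions n m"
  unfolding column_regions_def by blast

text \<open>The entry of row \<open>i\<close> in column \<open>j\<close>, counted from \<open>0\<close>, is at most \<open>x\<close> iff more than \<open>j\<close> entries of row \<open>i\<close>
  are. So this level set is the region of column \<open>j\<close> of \<open>T\<close>.\<close>

lemma level_set_in_column_regions:
  assumes T: "T \<in> SSYT n m" and j: "j < count_le T 0 m"
  shows "{(i, x). j < count_le T i x} \<in> column_regions n m"
proof -
  have "i < n" "0 < x" "j < count_le T i m" "\<forall>y \<ge> x. j < count_le T i y"
    if "j < count_le T i x" for i x
    using that count_le_SSYT[OF T, of i x] count_le_mono[of x _ T i]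
    by (force intro: gr0I)+
  moreover have "j < count_le T i x" if "j < count_le T (Suc i) (Suc x)" for i x
    using that count_le_Suc_Suc[of T i x] by simp
  ultimately show ?thesis
    using j unfolding column_regions_def by blast
qed

lemma rows_column:
  assumes "sorted_wrt (<) as" "\<forall>a \<in> set as. 0 < a"
  shows "rows (column as) = map (\<lambda>a. [a]) as"
proof -
  have "successively above (map (\<lambda>a. [a]) as)"
    using successively_if_sorted_wrt[OF assms(1)]
    by (auto simp: successively_map above_def elim: successively_mono)
  then have "is_ssyt (map (\<lambda>a. [a]) as)"
    using assms(2) by (auto simp: is_ssyt_def)
  then show ?thesis
    by (simp add: column_def Tableau_inverse)
qed

lemma count_le_column:
  assumes "sorted_wrt (<) as" "\<forall>a \<in> set as. 0 < a"
  shows "count_le (column as) i x = of_bool (i < length as \<and> as ! i \<le> x)"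
  using rows_column[OF assms] by (auto simp: count_le_def)

lemma region_column:
  assumes "sorted_wrt (<) as" "\<forall>a \<in> set as. 0 < a"
  shows "region (column as) = {(i, x). i < length as \<and> as ! i \<le> x}"
  using count_le_column[OF assms] by (auto simp: region_def)

lemma column_in_G_set:
  assumes "sorted_wrt (<) as" "set as \<subseteq> {1..m}" "as \<noteq> []" "length as \<le> n"
  shows "column as \<in> G_set n m"
proof -
  have "\<forall>a \<in> set as. 0 < a"
    using assms(2) by auto
  with rows_column[OF assms(1)] assms(2-4) show ?thesis
    by (auto simp: G_set_def SSYT_def)
qed

text \<open>The column is read off its region: the entry in row \<open>i\<close> is the least \<open>x\<close> with \<open>(i, x) \<in> D\<close>, and the rows
  that occur are those with \<open>(i, m) \<in> D\<close>.\<close>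

lemma column_with_region:
  assumes D: "D \<in> column_regions n m"
  shows "\<exists>c \<in> G_set n m. region c = D"
proof -
  have bot: "(0, m) \<in> D"
    and mem: "\<And>i x. (i, x) \<in> D \<Longrightarrow> i < n \<and> 0 < x \<and> (i, m) \<in> D"
    and up: "\<And>i x y. (i, x) \<in> D \<Longrightarrow> x \<le> y \<Longrightarrow> (i, y) \<in> D"
    and diag: "\<And>i x. (Suc i, Suc x) \<in> D \<Longrightarrow> (i, x) \<in> D"
    using D unfolding column_regions_def by blast+
  have down: "(i, m) \<in> D" if "(Suc i, m) \<in> D" for i
    using mem[OF that] diag[of i "m - 1"] that mem by (cases m) auto
  define h where "h = (LEAST i. (i, m) \<notin> D)"
  define a where "a i = (LEAST x. (i, x) \<in> D)" for i
  have "(n, m) \<notin> D"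
    using mem by blast
  then have h_out: "(h, m) \<notin> D" and h_le: "h \<le> n"
    unfolding h_def by (rule LeastI, rule Least_le)
  have out: "(h + k, m) \<notin> D" for k
    by (induction k) (use h_out down in auto)
  have height: "(i, m) \<in> D \<longleftrightarrow> i < h" for i
  proof
    show "i < h" if "(i, m) \<in> D"
      using out[of "i - h"] that by (cases "i < h") auto
    show "(i, m) \<in> D" if "i < h"
      using not_less_Least[of i "\<lambda>i. (i, m) \<notin> D"] that by (simp add: h_def)
  qed
  have a_in: "(i, a i) \<in> D" if "i < h" for i
    using that height[of i] unfolding a_def by (auto intro: LeastI)
  have a_le: "a i \<le> x" if "(i, x) \<in> D" for i x
    using that unfolding a_def by (rule Least_le)
  have a_Suc: "a i < a (Suc i)" if "Suc i < h" for i
  proof -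
    have "0 < a (Suc i)"
      using mem[OF a_in[OF that]] by simp
    then obtain y where y: "a (Suc i) = Suc y"
      using gr0_conv_Suc by blast
    then have "(i, y) \<in> D"
      using a_in[OF that] diag by simp
    then show ?thesis
      using a_le y by fastforce
  qed
  let ?as = "map a [0..<h]"
  have "0 < h"
    using bot height by blast
  have "successively (<) ?as"
    unfolding successively_conv_nth using a_Suc by simp
  then have sorted: "sorted_wrt (<) ?as"
    by (simp add: successively_conv_sorted_wrt transp_def)
  have entries: "set ?as \<subseteq> {1..m}"
    using a_in a_le height mem by (fastforce simp: Suc_le_eq)
  have "column ?as \<in> G_set n m"
    using sorted entries \<open>0 < h\<close> h_le by (intro column_in_G_set) auto
  moreover have "region (column ?as) = D"
  proof -
    have "\<forall>a \<in> set ?as. 0 < a"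
      using entries by auto
    then have "region (column ?as) = {(i, x). i < h \<and> a i \<le> x}"
      using region_column[OF sorted] by auto
    also have "\<dots> = D"
      using a_in a_le height mem up by blast
    finally show ?thesis .
  qed
  ultimately show ?thesis
    by blast
qed

lemma G_set_SSYT: "c \<in> G_set n m \<Longrightarrow> c \<in> SSYT n m"
  by (simp add: G_set_def)

lemma count_le_G_set:
  assumes "c \<in> G_set n m"
  shows "count_le c i x = of_bool ((i, x) \<in> region c)"
proof -
  have "count_le c i x \<le> 1"
  proof (cases "i < length (rows c)")
    case True
    then have "length (rows c ! i) = 1"
      using assms nth_mem[of i "rows c"] by (simp add: G_set_def)
    then show ?thesis
      using length_filter_le[of "\<lambda>y. y \<le> x" "rows c ! i"] by (simp add: count_le_def)
  qed (simp add: count_le_def)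
  then show ?thesis
    by (auto simp: region_def)
qed

lemma count_le_G_set_top:
  assumes "c \<in> G_set n m"
  shows "count_le c 0 m = 1"
proof -
  have c: "rows c ! 0 \<in> set (rows c)" "0 < length (rows c)" "length (rows c ! 0) = 1"
    using assms by (auto simp: G_set_def)
  then have "filter (\<lambda>y. y \<le> m) (rows c ! 0) = rows c ! 0"
    using assms by (force simp: G_set_def SSYT_def filter_id_conv)
  then show ?thesis
    using c by (simp add: count_le_def)
qed

lemma region_inject:
  assumes "c \<in> G_set n m" "d \<in> G_set n m" "region c = region d"
  shows "c = d"
  using assms by (intro count_le_inject) (simp add: count_le_G_set)

lemma region_in_column_regions:
  assumes "c \<in> G_set n m"
  shows "region c \<in> column_regions n m"
  using level_set_in_column_regions[of c n m 0] assms
  by (simp add: region_def count_le_G_set_top G_set_SSYT)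

lemma region_add: "region (T + U) = region T \<union> region U"
  by (auto simp: region_def count_le_plus)

text \<open>Sums of two columns correspond to sums of two indicator functions, which are determined by the
  union and the intersection of the two sets.\<close>

lemma sum_of_columns_eq_iff:
  assumes "{a, b, c, e} \<subseteq> G_set n m"
  shows "a + b = c + e \<longleftrightarrow>
    region a \<union> region b = region c \<union> region e \<and> region a \<inter> region b = region c \<inter> region e"
proof -
  have two_sets: "of_bool P + of_bool Q = (of_bool R + of_bool S :: nat)
      \<longleftrightarrow> (P \<or> Q \<longleftrightarrow> R \<or> S) \<and> (P \<and> Q \<longleftrightarrow> R \<and> S)" for P Q R S
    by (cases P; cases Q; cases R; cases S) simp_all
  have count: "count_le a i x = of_bool ((i, x) \<in> region a)"
    "count_le b i x = of_bool ((i, x) \<in> region b)" "count_le c i x = of_bool ((i, x) \<in> region c)"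
    "count_le e i x = of_bool ((i, x) \<in> region e)" for i x
    using assms count_le_G_set by auto
  have "a + b = c + e \<longleftrightarrow> (\<forall>i x. count_le (a + b) i x = count_le (c + e) i x)"
    using count_le_inject by metis
  also have "\<dots> \<longleftrightarrow> (\<forall>p. of_bool (p \<in> region a) + of_bool (p \<in> region b)
      = (of_bool (p \<in> region c) + of_bool (p \<in> region e) :: nat))"
    by (simp only: split_paired_All count_le_plus count)
  also have "\<dots> \<longleftrightarrow>
      (\<forall>p. (p \<in> region a \<union> region b \<longleftrightarrow> p \<in> region c \<union> region e)
         \<and> (p \<in> region a \<inter> region b \<longleftrightarrow> p \<in> region c \<inter> region e))"
    by (simp only: two_sets Un_iff Int_iff)
  finally show ?thesis
    by (simp only: set_eq_iff all_conj_distrib)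
qed

text \<open>Columns form a distributive lattice under union and intersection of regions, and the sum of two
  columns is the sum of their join and meet. These are the straightening relations.\<close>

lemma G_set_join_meet:
  assumes "a \<in> G_set n m" "b \<in> G_set n m"
  obtains c e where "c \<in> G_set n m" "e \<in> G_set n m" "a + b = c + e"
    "region c = region a \<union> region b"
proof -
  obtain c e where ce: "c \<in> G_set n m" "region c = region a \<union> region b"
      "e \<in> G_set n m" "region e = region a \<inter> region b"
    using column_with_region region_in_column_regions column_regions_Un column_regions_Int assms
    by metis
  moreover have "a + b = c + e"
    using assms ce by (subst sum_of_columns_eq_iff[where n = n and m = m]) auto
  ultimately show ?thesis
    using that by blast
qed

text \<open>A count is the number of the levels below it, so \<open>T\<close> is the sum of the columns whose regions are the
  level sets of its counts.\<close>

lemma SSYT_is_sum_of_columns: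
  assumes "T \<in> SSYT n m"
  shows "\<exists>M. set_mset M \<subseteq> G_set n m \<and> sum_mset M = T"
proof -
  let ?k = "count_le T 0 m"
  have "\<forall>j \<in> {..<?k}. \<exists>c \<in> G_set n m. region c = {(i, x). j < count_le T i x}"
    using level_set_in_column_regions[OF assms] column_with_region by blast
  then obtain c where c: "\<And>j. j < ?k \<Longrightarrow> c j \<in> G_set n m"
      "\<And>j. j < ?k \<Longrightarrow> region (c j) = {(i, x). j < count_le T i x}"
    by (metis lessThan_iff)
  have "(\<Sum>j<?k. c j) = T"
  proof (rule count_le_inject)
    fix i x
    have "count_le T i x \<le> ?k"
      using count_le_le_row_0[of T i x] count_le_SSYT(1)[OF assms, of 0 x] by simp
    then have "{j. j < ?k \<and> j < count_le T i x} = {..<count_le T i x}"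
      by auto
    moreover have "count_le (\<Sum>j<?k. c j) i x = (\<Sum>j<?k. of_bool (j < count_le T i x))"
      unfolding count_le_sum 
      using c count_le_G_set[OF c(1)] by (intro sum.cong refl) auto
    ultimately show "count_le (\<Sum>j<?k. c j) i x = count_le T i x"
      by (simp add: sum.If_cases of_bool_def lessThan_def Int_def)
  qed
  then show ?thesis
    using c(1) by (intro exI[of _ "image_mset c (mset_set {..<?k})"]) (auto simp: sum_unfold_sum_mset)
qed


section \<open>Tuples compatible with the product relations\<close>

text \<open>The next three lemmas describe how a point of a column region forces others: diagonally upwards,
  to the right, and, if it lies on the boundary \<open>x = i + 1\<close> of the largest possible region, a whole
  staircase.\<close>

lemma column_regions_below:
  assumes D: "D \<in> column_regions n m" and "(i + k, x + k) \<in> D"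
  shows "(i, x) \<in> D"
  using assms(2)
proof (induction k)
  case (Suc k)
  then have "(Suc (i + k), Suc (x + k)) \<in> D"
    by simp
  then have "(i + k, x + k) \<in> D"
    using D unfolding column_regions_def by blast
  then show ?case
    by (rule Suc.IH)
qed simp

lemma column_regions_bounds:
  assumes D: "D \<in> column_regions n m" and ix: "(i, x) \<in> D"
  shows "i < n" "i < x" "(i, m) \<in> D" "x \<le> y \<Longrightarrow> (i, y) \<in> D"
proof -
  show "i < n" "(i, m) \<in> D" "x \<le> y \<Longrightarrow> (i, y) \<in> D"
    using D ix unfolding column_regions_def by blast+
  show "i < x"
  proof (rule ccontr)
    assume "\<not> i < x"
    then have "(i - x, 0) \<in> D"
      using column_regions_below[OF D, of "i - x" x 0] ix by simp
    then show False
      using D unfolding column_regions_def by blast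
  qed
qed

lemma column_regions_staircase:
  assumes D: "D \<in> column_regions n m" and "(k, Suc k) \<in> D" and ix: "i \<le> k" "i < x"
  shows "(i, x) \<in> D"
proof -
  have "(i, Suc i) \<in> D"
    using column_regions_below[OF D, of i "k - i" "Suc i"] assms by simp
  then show ?thesis
    using column_regions_bounds(4)[OF D] ix(2) Suc_leI by blast
qed

lemma region_column_interval: "region (column [1..<Suc k]) = {(i, x). i < k \<and> i < x}"
proof -
  have "\<forall>a \<in> set [1..<Suc k]. 0 < a"
    by auto
  then show ?thesis
    using region_column[OF sorted_wrt_upt] by (auto simp del: upt_Suc)
qed

text \<open>The column \<open>[m]\<close> has the smallest region, so a relation would express that region as an intersection
  of two others. One of these must omit \<open>(0, m - 1)\<close>; the only column with this property is \<open>[m]\<close>.\<close>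

lemma product_relation_avoids_max_entry_column:
  assumes G: "{a, b, c, e} \<subseteq> G_set n m" and "0 < m"
    and dist: "distinct [a, b, c, e]" and eq: "a + b = c + e"
  shows "a \<noteq> column [m]"
proof
  assume "a = column [m]"
  then have "region a = {(i, x). i < length [m] \<and> [m] ! i \<le> x}"
    using \<open>0 < m\<close> region_column[of "[m]"] by simp
  also have "\<dots> = {(i, x). i = 0 \<and> m \<le> x}"
    by auto
  finally have a: "region a = {(i, x). i = 0 \<and> m \<le> x}" .
  have G': "region d \<in> column_regions n m" if "d \<in> {a, b, c, e}" for d
    using region_in_column_regions that G by blast
  have top: "(0, m) \<in> region d" if "d \<in> {a, b, c, e}" for d
    using G'[OF that] unfolding column_regions_def by blast
  have contains: "region a \<subseteq> region d" if "d \<in> {a, b, c, e}" for d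
  proof
    fix p assume "p \<in> region a"
    then obtain x where "p = (0, x)" "m \<le> x"
      using a by auto
    then show "p \<in> region d"
      using column_regions_bounds(4)[OF G'[OF that] top[OF that]] by simp
  qed
  have "region c \<inter> region e = region a"
    using contains[of b] eq sum_of_columns_eq_iff[OF G] by (simp add: Int_absorb2)
  moreover have "(0, m - 1) \<notin> region a"
    using a \<open>0 < m\<close> by simp
  ultimately have "(0, m - 1) \<notin> region c \<or> (0, m - 1) \<notin> region e"
    by blast
  moreover have equals_a: "d = a" if d: "d \<in> {a, b, c, e}" and out: "(0, m - 1) \<notin> region d" for d
  proof -
    have "(i, x) \<in> region a" if ix: "(i, x) \<in> region d" for i x
    proof -
      have "i = 0"
      proof (rule ccontr)
        assume "i \<noteq> 0"
        have im: "(i, m) \<in> region d"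
          by (rule column_regions_bounds(3)[OF G'[OF d] ix])
        have "i < m"
          by (rule column_regions_bounds(2)[OF G'[OF d] im])
        with im have "(0 + i, m - i + i) \<in> region d"
          by simp
        then have "(0, m - i) \<in> region d"
          by (rule column_regions_below[OF G'[OF d]])
        then have "(0, m - 1) \<in> region d"
          by (rule column_regions_bounds(4)[OF G'[OF d]]) (use \<open>i \<noteq> 0\<close> in simp)
        with out show False ..
      qed
      moreover have "m \<le> x"
      proof (rule ccontr)
        assume "\<not> m \<le> x"
        then have "(i, m - 1) \<in> region d"
          by (intro column_regions_bounds(4)[OF G'[OF d] ix]) simp
        with out \<open>i = 0\<close> show False
          by simp
      qed
      ultimately show ?thesis
        using a by simp
    qed
    then have "region d = region a"
      using contains[OF d] by auto
    then show "d = a"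
      using region_inject d G by blast
  qed
  ultimately have "c = a \<or> e = a"
    using equals_a[of c] equals_a[of e] by blast
  then show False
    using dist by auto
qed

text \<open>Dually, the column \<open>[1, \<dots>, n]\<close> has the largest region, and it is the only column whose region contains
  the corner \<open>(n - 1, n)\<close>. In a relation that involves it, a column on the other side also contains the
  corner.\<close>

lemma product_relation_avoids_full_column:
  assumes G: "{a, b, c, e} \<subseteq> G_set n m" and "0 < n"
    and dist: "distinct [a, b, c, e]" and eq: "a + b = c + e"
  shows "region a \<noteq> {(i, x). i < n \<and> i < x}"
proof
  assume a: "region a = {(i, x). i < n \<and> i < x}"
  have G': "region d \<in> column_regions n m" if "d \<in> {a, b, c, e}" for d
    using region_in_column_regions that G by blast
  have below: "region d \<subseteq> region a" if "d \<in> {a, b, c, e}" for d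
    using column_regions_bounds(1,2)[OF G'[OF that]] a by auto
  have "(n - 1, Suc (n - 1)) \<in> region c \<union> region e"
    using eq sum_of_columns_eq_iff[OF G] a \<open>0 < n\<close> by auto
  moreover have equals_a: "d = a" if d: "d \<in> {a, b, c, e}" and corner: "(n - 1, Suc (n - 1)) \<in> region d" for d
  proof -
    have "region a \<subseteq> region d"
      using column_regions_staircase[OF G'[OF d] corner] a by auto
    then have "region d = region a"
      using below[OF d] by auto
    then show "d = a"
      using region_inject d G by blast
  qed
  ultimately have "c = a \<or> e = a"
    using equals_a[of c] equals_a[of e] by blast
  then show False
    using dist by auto
qed

text \<open>For \<open>m = n\<close>, the columns whose regions contain \<open>(n - 2, n - 1)\<close> are just \<open>[1, \<dots>, n - 1]\<close> and
  \<open>[1, \<dots>, n]\<close>. So a relation with the first on one side has the second on the other, which is excluded by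
  \<open>product_relation_avoids_full_column\<close>.\<close>

lemma product_relation_avoids_short_column:
  assumes G: "{a, b, c, e} \<subseteq> G_set n n" and "1 < n"
    and dist: "distinct [a, b, c, e]" and eq: "a + b = c + e"
  shows "region a \<noteq> {(i, x). i < n - 1 \<and> i < x}"
proof
  assume a: "region a = {(i, x). i < n - 1 \<and> i < x}"
  have "(n - 2, Suc (n - 2)) \<in> region c \<union> region e"
    using eq sum_of_columns_eq_iff[OF G] a \<open>1 < n\<close> by auto
  moreover have contradiction: False if G: "{a, b, c, e} \<subseteq> G_set n n" and dist: "distinct [a, b, c, e]"
    and eq: "a + b = c + e" and corner: "(n - 2, Suc (n - 2)) \<in> region c" for c e
  proof -
    have C: "region c \<in> column_regions n n"
      using region_in_column_regions G by blast
    have sub: "region a \<subseteq> region c"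
      using column_regions_staircase[OF C corner] a by auto
    show False
    proof (cases "(n - 1, n) \<in> region c")
      case True
      have "region c = {(i, x). i < n \<and> i < x}"
        using column_regions_staircase[OF C, of "n - 1"] True column_regions_bounds(1,2)[OF C] \<open>1 < n\<close>
        by auto
      moreover have "{c, e, a, b} \<subseteq> G_set n n" "distinct [c, e, a, b]" "c + e = a + b"
        using G dist eq by auto
      ultimately show False
        using product_relation_avoids_full_column[of c e a b n n] \<open>1 < n\<close> by simp
    next
      case False
      have "i < n - 1" if "(i, x) \<in> region c" for i x
      proof (rule ccontr)
        assume "\<not> i < n - 1"
        then have "i = n - 1"
          using column_regions_bounds(1)[OF C that] by simp
        then show False
          using False column_regions_bounds(3)[OF C that] by simp
      qed
      then have "region c = region a"
        using sub a column_regions_bounds(2)[OF C] by auto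
      then show False
        using region_inject[of c n n a] G dist by auto
    qed
  qed
  moreover have "{a, b, e, c} \<subseteq> G_set n n" "distinct [a, b, e, c]" "a + b = e + c"
    using G dist eq by (auto simp: add.commute)
  ultimately show False
    using contradiction[OF G dist eq] contradiction[of e c] by blast
qed

text \<open>Therefore a tuple restricted to \<open>E_set\<close> is defined at each variable of a product relation. Outside
  \<open>E_set\<close> the restriction takes the value \<open>undefined\<close>.\<close>

lemma product_relation_in_E_set:
  assumes "0 < n" "n \<le> m"
    and G: "{a, b, c, e} \<subseteq> G_set n m" and dist: "distinct [a, b, c, e]" and eq: "a + b = c + e"
  shows "{a, b, c, e} \<subseteq> E_set n m"
proof -
  have first: "a \<in> E_set n m"
    if G: "{a, b, c, e} \<subseteq> G_set n m" and dist: "distinct [a, b, c, e]" and eq: "a + b = c + e"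
    for a b c e
  proof -
    have "a \<noteq> column [m]"
      using product_relation_avoids_max_entry_column[OF G _ dist eq] assms(1,2) by simp
    moreover have "a \<noteq> column [1..<Suc n]"
      using product_relation_avoids_full_column[OF G assms(1) dist eq] region_column_interval by metis
    moreover have "a \<noteq> column [1..<n]" if "m = n" "n \<noteq> 1"
    proof -
      have "1 < n"
        using that assms(1) by simp
      then have "region (column [1..<n]) = {(i, x). i < n - 1 \<and> i < x}"
        using region_column_interval[of "n - 1"] by simp
      with \<open>1 < n\<close> show ?thesis
        using product_relation_avoids_short_column[of a b c e n] G dist eq \<open>m = n\<close> by auto
    qed
    ultimately show "a \<in> E_set n m"
      using G by (auto simp: E_set_def F_set_def)
  qed
  have "b \<in> E_set n m"
    by (rule first[of b a c e]) (use G dist eq in \<open>auto simp: add.commute\<close>)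
  moreover have "c \<in> E_set n m"
    by (rule first[of c e a b]) (use G dist eq in auto)
  moreover have "e \<in> E_set n m"
    by (rule first[of e c a b]) (use G dist eq in \<open>auto simp: add.commute\<close>)
  ultimately show ?thesis
    using first[OF G dist eq] by simp
qed

text \<open>Coinciding columns are allowed, so that straightening needs no distinction of cases.\<close>

definition respects_relations :: "nat \<Rightarrow> nat \<Rightarrow> (ssyt \<Rightarrow> 'k::field) \<Rightarrow> bool" where
  "respects_relations n m t \<longleftrightarrow>
    (\<forall>a b c e. {a, b, c, e} \<subseteq> G_set n m \<longrightarrow> a + b = c + e \<longrightarrow> t a * t b = t c * t e)"

text \<open>If two of the four columns coincide, then the two sides consist of the same columns: cancel if the
  coincidence is between the sides, and compare unions with intersections if it is within a side.\<close>

lemma trivial_relation: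
  assumes G: "{a, b, c, e} \<subseteq> G_set n m" and eq: "a + b = c + e" and "\<not> distinct [a, b, c, e]"
  shows "a = c \<and> b = e \<or> a = e \<and> b = c"
proof -
  have double: "c = a \<and> e = a" if "{a, c, e} \<subseteq> G_set n m" "a + a = c + e" for a c e
  proof -
    have "region a = region c \<union> region e" "region a = region c \<inter> region e"
      using sum_of_columns_eq_iff[of a a c e n m] that by auto
    then have "region c = region a" "region e = region a"
      by auto
    then show ?thesis
      using region_inject that(1) by blast
  qed
  consider "a = b" | "c = e" | "a = c" | "a = e" | "b = c" | "b = e"
    using assms(3) by auto
  then show ?thesis
  proof cases
    case 1
    then show ?thesis using double[of a c e] G eq by auto
  next
    case 2
    then show ?thesis using double[of c a b] G eq by auto
  next
    case 3
    then show ?thesis using ssyt_add_left_cancel eq by blast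
  next
    case 4
    then show ?thesis using ssyt_add_left_cancel[of e b c] eq by (simp add: add.commute)
  next
    case 5
    then show ?thesis using ssyt_add_left_cancel[of c a e] eq by (simp add: add.commute)
  next
    case 6
    then show ?thesis using ssyt_add_left_cancel[of e a c] eq by (simp add: add.commute)
  qed
qed

lemma respects_relations_iff_product_relations:
  "respects_relations n m t \<longleftrightarrow> (\<forall>a b c e. {a, b, c, e} \<subseteq> G_set n m \<longrightarrow>
     distinct [a, b, c, e] \<longrightarrow> a + b = c + e \<longrightarrow> t a * t b = t c * t e)"
proof (intro iffI allI impI)
  assume *: "\<forall>a b c e. {a, b, c, e} \<subseteq> G_set n m \<longrightarrow>
     distinct [a, b, c, e] \<longrightarrow> a + b = c + e \<longrightarrow> t a * t b = t c * t e"
  show "respects_relations n m t"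
    unfolding respects_relations_def
  proof (intro allI impI)
    fix a b c e assume abce: "{a, b, c, e} \<subseteq> G_set n m" "a + b = c + e"
    show "t a * t b = t c * t e"
    proof (cases "distinct [a, b, c, e]")
      case True
      with abce * show ?thesis by blast
    next
      case False
      with trivial_relation[OF abce] show ?thesis
        by (auto simp: mult.commute)
    qed
  qed
qed (unfold respects_relations_def, blast)

text \<open>The point is that vanishing on the product relations implies vanishing on the ideal. With this
  description, closure of the ordinary tuples under products and inverses becomes evident.\<close>

lemma tuples_iff:
  fixes t :: "ssyt \<Rightarrow> 'k::field"
  assumes "0 < n" "n \<le> m"
  shows "t \<in> tuples n m \<longleftrightarrow> t \<in> extensional (G_set n m) \<and> respects_relations n m t"
proof -
  let ?x = "restrict t (E_set n m)"
  let ?A = "{e. Poly_Mapping.keys e \<subseteq> E_set n m} :: (ssyt \<Rightarrow>\<^sub>0 nat) set"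
  let ?S = "product_relations n m :: ((ssyt \<Rightarrow>\<^sub>0 nat) \<Rightarrow>\<^sub>0 'k) set"
  have in_ideal: "?S \<subseteq> P_ideal n m"
    by (auto simp: P_ideal_def genideal_def)
  have x: "?x a * ?x b - ?x c * ?x e = t a * t b - t c * t e"
    if "{a, b, c, e} \<subseteq> G_set n m" "distinct [a, b, c, e]" "a + b = c + e" for a b c e
    using product_relation_in_E_set[OF assms that] by simp
  have vanishing: "(\<forall>p \<in> ?S. poly_eval ?x p = 0) \<longleftrightarrow> respects_relations n m t"
  proof -
    have "(\<forall>p \<in> ?S. poly_eval ?x p = 0) \<longleftrightarrow> (\<forall>a b c e. {a, b, c, e} \<subseteq> G_set n m \<longrightarrow>
        distinct [a, b, c, e] \<longrightarrow> a + b = c + e \<longrightarrow> ?x a * ?x b - ?x c * ?x e = 0)"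
      unfolding product_relations_def
    proof (intro iffI allI impI ballI)
      fix a b c e
      assume "\<forall>p \<in> {poly_var a * poly_var b - poly_var c * poly_var e | a b c e.
           {a, b, c, e} \<subseteq> G_set n m \<and> distinct [a, b, c, e] \<and> a + b = c + e}. poly_eval ?x p = 0"
        and "{a, b, c, e} \<subseteq> G_set n m" "distinct [a, b, c, e]" "a + b = c + e"
      then have "poly_eval ?x (poly_var a * poly_var b - poly_var c * poly_var e) = 0"
        by blast
      then show "?x a * ?x b - ?x c * ?x e = 0"
        by (simp only: poly_eval_binomial)
    next
      fix p :: "(ssyt \<Rightarrow>\<^sub>0 nat) \<Rightarrow>\<^sub>0 'k"
      assume *: "\<forall>a b c e. {a, b, c, e} \<subseteq> G_set n m \<longrightarrow>
        distinct [a, b, c, e] \<longrightarrow> a + b = c + e \<longrightarrow> ?x a * ?x b - ?x c * ?x e = 0"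
        and "p \<in> {poly_var a * poly_var b - poly_var c * poly_var e | a b c e.
           {a, b, c, e} \<subseteq> G_set n m \<and> distinct [a, b, c, e] \<and> a + b = c + e}"
      then obtain a b c e where "p = poly_var a * poly_var b - poly_var c * poly_var e"
          "{a, b, c, e} \<subseteq> G_set n m" "distinct [a, b, c, e]" "a + b = c + e"
        by blast
      with * show "poly_eval ?x p = 0"
        by (simp only: poly_eval_binomial)
    qed
    also have "\<dots> \<longleftrightarrow> respects_relations n m t"
      unfolding respects_relations_iff_product_relations using x
      by (simp only: right_minus_eq cong: imp_cong)
    finally show ?thesis .
  qed
  have "(\<forall>p \<in> P_ideal n m. poly_eval ?x p = 0) \<longleftrightarrow> (\<forall>p \<in> ?S. poly_eval ?x p = 0)"
  proof (intro iffI ballI)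
    fix p :: "(ssyt \<Rightarrow>\<^sub>0 nat) \<Rightarrow>\<^sub>0 'k"
    assume zero: "\<forall>p \<in> ?S. poly_eval ?x p = 0" and p: "p \<in> P_ideal n m"
    have carrier: "?S \<subseteq> carrier (monoid_algebra ?A)"
    proof
      fix q assume "q \<in> ?S"
      then obtain a b c e where q: "q = poly_var a * poly_var b - poly_var c * poly_var e"
          and "{a, b, c, e} \<subseteq> G_set n m" "distinct [a, b, c, e]" "a + b = c + e"
        unfolding product_relations_def by blast
      then have "{a, b, c, e} \<subseteq> E_set n m"
        using product_relation_in_E_set[OF assms] by blast
      then have "Poly_Mapping.keys (poly_var a * poly_var b :: (ssyt \<Rightarrow>\<^sub>0 nat) \<Rightarrow>\<^sub>0 'k) \<subseteq> ?A"
          "Poly_Mapping.keys (poly_var c * poly_var e :: (ssyt \<Rightarrow>\<^sub>0 nat) \<Rightarrow>\<^sub>0 'k) \<subseteq> ?A"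
        by (simp_all add: keys_poly_var_mult)
      then have "Poly_Mapping.keys q \<subseteq> ?A"
        unfolding q by (intro order_trans[OF keys_diff] Un_least)
      then show "q \<in> carrier (monoid_algebra ?A)"
        by (simp add: monoid_algebra_def)
    qed
    have "lin_ext (monomial_value ?x) p = 0"
    proof (rule genideal_in_kernel[OF _ _ monomial_value_add carrier])
      show "d + e \<in> ?A" if "d \<in> ?A" "e \<in> ?A" for d e
        using that keys_add[of d e] by auto
      show "lin_ext (monomial_value ?x) q = 0" if "q \<in> ?S" for q
        using zero that by (simp only: poly_eval_eq_lin_ext)
      show "p \<in> genideal (monoid_algebra ?A) ?S"
        using p by (simp only: P_ideal_def poly_ring_def)
    qed simp
    then show "poly_eval ?x p = 0"
      by (simp only: poly_eval_eq_lin_ext)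
  qed (use in_ideal in blast)
  with vanishing show ?thesis
    by (simp add: tuples_def zero_locus_def PiE_def)
qed

lemma ordinary_tuples_iff:
  assumes "0 < n" "n \<le> m"
  shows "t \<in> ordinary_tuples n m \<longleftrightarrow> t \<in> extensional (G_set n m) \<and> respects_relations n m t
     \<and> (\<forall>T \<in> G_set n m. t T \<noteq> 0)"
  by (auto simp: ordinary_tuples_def tuples_iff[OF assms])


section \<open>Evaluating tableaux at a tuple\<close>

abbreviation column_product :: "(ssyt \<Rightarrow> 'k::field) \<Rightarrow> ssyt multiset \<Rightarrow> 'k" where
  "column_product t M \<equiv> prod_mset (image_mset t M)"

lemma respects_relationsD:
  assumes "respects_relations n m t" "a \<in> G_set n m" "b \<in> G_set n m" "c \<in> G_set n m"
    "e \<in> G_set n m" "a + b = c + e"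
  shows "t a * t b = t c * t e"
  using assms unfolding respects_relations_def by blast

text \<open>Every column has exactly one entry in row \<open>0\<close>, so the number of columns in a decomposition is
  determined by the sum.\<close>

lemma size_eq_count_le:
  "set_mset M \<subseteq> G_set n m \<Longrightarrow> count_le (sum_mset M) 0 m = size M"
  by (induction M) (auto simp: count_le_plus count_le_G_set_top)

text \<open>Straightening: exchanging successive columns for their joins and meets collects the union of all
  regions in a single column. By the relations, neither the sum nor the product of the values changes.
  The region of the extracted column depends on the sum only.\<close>

lemma extract_first_column:
  assumes t: "respects_relations n m t"
    and "set_mset M \<subseteq> G_set n m" "M \<noteq> {#}"
  shows "\<exists>c N. c \<in> G_set n m \<and> set_mset N \<subseteq> G_set n m \<and> region c = region (sum_mset M)
    \<and> sum_mset M = c + sum_mset N \<and> column_product t M = t c * column_product t N"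
  using assms(2,3)
proof (induction M)
  case (add a M)
  show ?case
  proof (cases "M = {#}")
    case True
    then show ?thesis
      using add.prems by (intro exI[of _ a] exI[of _ "{#}"]) auto
  next
    case False
    then obtain c N where c: "c \<in> G_set n m" and N: "set_mset N \<subseteq> G_set n m"
        and reg: "region c = region (sum_mset M)"
        and sum: "sum_mset M = c + sum_mset N"
        and prod: "column_product t M = t c * column_product t N"
      using add.IH add.prems by auto
    have a: "a \<in> G_set n m"
      using add.prems by simp
    obtain c' e where ce: "c' \<in> G_set n m" "e \<in> G_set n m" "a + c = c' + e"
        "region c' = region a \<union> region c"
      using G_set_join_meet[OF a c] .
    have "t a * t c = t c' * t e"
      using respects_relationsD[OF t a c ce(1,2,3)] .
    then have "column_product t (add_mset a M) = t c' * column_product t (add_mset e N)"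
      by (simp add: prod mult.assoc[symmetric])
    moreover have "sum_mset (add_mset a M) = c' + sum_mset (add_mset e N)"
      using ce(3) by (simp add: sum add.assoc[symmetric])
    moreover have "region c' = region (sum_mset (add_mset a M))"
      by (simp add: ce(4) reg region_add)
    ultimately show ?thesis
      using ce N by (intro exI[of _ c'] exI[of _ "add_mset e N"]) simp
  qed
qed simp

text \<open>Extract the first columns of both sides. They have the same region, so they agree and can be
  cancelled, and there are fewer columns left. This says that every multiplicative relation between
  columns is a consequence of the quadratic ones.\<close>

lemma column_product_cong:
  assumes t: "respects_relations n m t"
    and "set_mset M \<subseteq> G_set n m" "set_mset N \<subseteq> G_set n m" "sum_mset M = sum_mset N"
  shows "column_product t M = column_product t N"
  using assms(2-)
proof (induction "size M" arbitrary: M N)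
  case 0
  then show ?case
    using size_eq_count_le[of M n m] size_eq_count_le[of N n m] by simp
next
  case (Suc k)
  have "size N = size M"
    using size_eq_count_le Suc.prems by metis
  then have "M \<noteq> {#}" "N \<noteq> {#}"
    using Suc.hyps(2) by auto
  obtain c M' where M': "c \<in> G_set n m" "set_mset M' \<subseteq> G_set n m" "region c = region (sum_mset M)"
      "sum_mset M = c + sum_mset M'" "column_product t M = t c * column_product t M'"
    using extract_first_column[OF t Suc.prems(1) \<open>M \<noteq> {#}\<close>] by blast
  obtain d N' where N': "d \<in> G_set n m" "set_mset N' \<subseteq> G_set n m" "region d = region (sum_mset N)"
      "sum_mset N = d + sum_mset N'" "column_product t N = t d * column_product t N'"
    using extract_first_column[OF t Suc.prems(2) \<open>N \<noteq> {#}\<close>] by blast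
  have "c = d"
    using region_inject M' N' Suc.prems(3) by metis
  then have sums: "sum_mset M' = sum_mset N'"
    using M' N' Suc.prems(3) ssyt_add_left_cancel by metis
  have "size M = Suc (size M')"
    using size_eq_count_le[OF Suc.prems(1)] size_eq_count_le[OF M'(2)] M'(4)
      count_le_G_set_top[OF M'(1)] by (simp add: count_le_plus)
  then have "k = size M'"
    using Suc.hyps(2) by simp
  from Suc.hyps(1)[OF this M'(2) N'(2) sums] show ?case
    by (simp only: M'(5) N'(5) \<open>c = d\<close>)
qed

text \<open>The value of a tableau is the product of the values of the columns in a decomposition; by
  \<open>column_product_cong\<close> the choice is immaterial for tuples that respect the relations.\<close>

definition tableau_value :: "nat \<Rightarrow> nat \<Rightarrow> (ssyt \<Rightarrow> 'k::field) \<Rightarrow> ssyt \<Rightarrow> 'k" where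
  "tableau_value n m t T =
    column_product t (SOME M. set_mset M \<subseteq> G_set n m \<and> sum_mset M = T)"

lemma tableau_value_sum_mset:
  assumes "respects_relations n m t" "set_mset M \<subseteq> G_set n m"
  shows "tableau_value n m t (sum_mset M) = column_product t M"
proof -
  let ?P = "\<lambda>N. set_mset N \<subseteq> G_set n m \<and> sum_mset N = sum_mset M"
  have "?P (SOME N. ?P N)"
    by (rule someI[of ?P M]) (use assms(2) in simp)
  then show ?thesis
    unfolding tableau_value_def using assms by (intro column_product_cong) auto
qed

lemma tableau_value_plus:
  assumes "respects_relations n m t" "T \<in> SSYT n m" "U \<in> SSYT n m"
  shows "tableau_value n m t (T + U) = tableau_value n m t T * tableau_value n m t U"
proof -
  obtain M N where "set_mset M \<subseteq> G_set n m" "sum_mset M = T" "set_mset N \<subseteq> G_set n m" "sum_mset N = U"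
    using SSYT_is_sum_of_columns assms(2,3) by metis
  then show ?thesis
    using tableau_value_sum_mset[OF assms(1), of M] tableau_value_sum_mset[OF assms(1), of N]
      tableau_value_sum_mset[OF assms(1), of "M + N"] by simp
qed

lemma tableau_value_column:
  assumes "respects_relations n m t" "c \<in> G_set n m"
  shows "tableau_value n m t c = t c"
  using tableau_value_sum_mset[OF assms(1), of "{#c#}"] assms(2) by simp

lemma tableau_value_zero: "respects_relations n m t \<Longrightarrow> tableau_value n m t 0 = 1"
  using tableau_value_sum_mset[of n m t "{#}"] by simp


section \<open>Recovering a tuple from its ideal and from its projection\<close>

lemma cring_tableaux_algebra: "cring (tableaux_algebra n m :: (ssyt \<Rightarrow>\<^sub>0 'k::field) ring)"
  unfolding tableaux_algebra_def by (rule cring_monoid_algebra[OF SSYT_zero SSYT_plus])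

lemma single_in_tableaux_algebra:
  "T \<in> SSYT n m \<Longrightarrow> Poly_Mapping.single T c \<in> carrier (tableaux_algebra n m)"
  by (auto simp: tableaux_algebra_def monoid_algebra_def)

lemma minus_tableaux_algebra:
  fixes f g :: "ssyt \<Rightarrow>\<^sub>0 'k::field"
  assumes "f \<in> carrier (tableaux_algebra n m)" "g \<in> carrier (tableaux_algebra n m)"
  shows "f \<ominus>\<^bsub>tableaux_algebra n m\<^esub> g = f - g"
  using minus_monoid_algebra[where f = g and A = "SSYT n m", OF SSYT_zero SSYT_plus] assms(2)
  by (simp add: a_minus_def tableaux_algebra_def) (simp add: monoid_algebra_def)

lemma generators_in_carrier:
  "{Poly_Mapping.single T 1 - Poly_Mapping.single 0 (t T) | T. T \<in> G_set n m}
    \<subseteq> carrier (tableaux_algebra n m :: (ssyt \<Rightarrow>\<^sub>0 'k::field) ring)"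
proof clarify
  fix T assume "T \<in> G_set n m"
  then have "{T, 0} \<subseteq> SSYT n m"
    using SSYT_zero G_set_SSYT by blast
  moreover have "Poly_Mapping.keys (Poly_Mapping.single T 1 - Poly_Mapping.single 0 (t T) :: ssyt \<Rightarrow>\<^sub>0 'k)
      \<subseteq> {T, 0}"
    by (rule order_trans[OF keys_diff]) auto
  ultimately show "Poly_Mapping.single T 1 - Poly_Mapping.single 0 (t T)
      \<in> carrier (tableaux_algebra n m :: (ssyt \<Rightarrow>\<^sub>0 'k) ring)"
    by (auto simp: tableaux_algebra_def monoid_algebra_def)
qed

lemma ideal_max_ideal:
  "ideal (max_ideal n m t) (tableaux_algebra n m :: (ssyt \<Rightarrow>\<^sub>0 'k::field) ring)"
proof -
  interpret cring "tableaux_algebra n m :: (ssyt \<Rightarrow>\<^sub>0 'k) ring"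
    by (rule cring_tableaux_algebra)
  show ?thesis
    unfolding max_ideal_def using generators_in_carrier by (rule genideal_ideal)
qed

lemma column_minus_scalar_in_max_ideal:
  "T \<in> G_set n m \<Longrightarrow> Poly_Mapping.single T 1 - Poly_Mapping.single 0 (t T) \<in> max_ideal n m t"
  unfolding max_ideal_def genideal_def by blast

text \<open>So \<open>tableau_value n m t\<close> extends to a ring homomorphism from the tableaux algebra to \<open>K\<close> that kills
  \<open>max_ideal n m t\<close>. It sends \<open>1\<close> to \<open>1\<close>, so this ideal is proper and its cosets separate scalars.\<close>

lemma tableau_value_vanishes_on_max_ideal:
  assumes t: "respects_relations n m t" and f: "f \<in> max_ideal n m t"
  shows "lin_ext (tableau_value n m t) f = 0"
proof (rule genideal_in_kernel[OF SSYT_zero SSYT_plus tableau_value_plus[OF t]])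
  let ?S = "{Poly_Mapping.single T 1 - Poly_Mapping.single 0 (t T) | T. T \<in> G_set n m}"
  show "?S \<subseteq> carrier (monoid_algebra (SSYT n m))"
    using generators_in_carrier by (simp only: tableaux_algebra_def)
  show "lin_ext (tableau_value n m t) g = 0" if "g \<in> ?S" for g
    using that t by (auto simp: lin_ext_diff tableau_value_column tableau_value_zero)
  show "f \<in> genideal (monoid_algebra (SSYT n m)) ?S"
    using f by (simp only: max_ideal_def tableaux_algebra_def)
qed

text \<open>If \<open>t\<close> and \<open>s\<close> give the same ideal, then it contains both \<open>T - t T\<close> and \<open>T - s T\<close>. Apply the
  homomorphism of \<open>t\<close> to the latter.\<close>

lemma inj_on_max_ideal:
  assumes "0 < n" "n \<le> m"
  shows "inj_on (max_ideal n m :: (ssyt \<Rightarrow> 'k::field) \<Rightarrow> _) (ordinary_tuples n m)"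
proof (rule inj_onI)
  fix t s :: "ssyt \<Rightarrow> 'k"
  assume "t \<in> ordinary_tuples n m" "s \<in> ordinary_tuples n m"
    and eq: "max_ideal n m t = max_ideal n m s"
  then have t: "respects_relations n m t" "t \<in> extensional (G_set n m)" "s \<in> extensional (G_set n m)"
    by (auto simp: ordinary_tuples_iff[OF assms])
  show "t = s"
  proof (rule extensionalityI[OF t(2,3)])
    fix T assume T: "T \<in> G_set n m"
    then have "Poly_Mapping.single T 1 - Poly_Mapping.single 0 (s T) \<in> max_ideal n m t"
      unfolding eq by (rule column_minus_scalar_in_max_ideal)
    from tableau_value_vanishes_on_max_ideal[OF t(1) this] show "t T = s T"
      using t(1) T by (simp add: lin_ext_diff tableau_value_column tableau_value_zero)
  qed
qed

text \<open>\<open>T\<close> and the scalar \<open>t T\<close> lie in the same coset, and different scalars lie in different cosets.\<close>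

lemma projection_column:
  fixes t :: "ssyt \<Rightarrow> 'k::field"
  assumes t: "respects_relations n m t" and T: "T \<in> G_set n m"
  shows "projection n m t (Poly_Mapping.single T 1) = t T"
proof -
  let ?R = "tableaux_algebra n m :: (ssyt \<Rightarrow>\<^sub>0 'k) ring"
  let ?c = "\<lambda>c. max_ideal n m t +>\<^bsub>?R\<^esub> Poly_Mapping.single 0 c"
  interpret cring ?R
    by (rule cring_tableaux_algebra)
  have coset_eq: "max_ideal n m t +>\<^bsub>?R\<^esub> f = max_ideal n m t +>\<^bsub>?R\<^esub> g \<longleftrightarrow> f - g \<in> max_ideal n m t"
    if "f \<in> carrier ?R" "g \<in> carrier ?R" for f g
    using quotient_eq_iff_same_a_r_cos[OF ideal_max_ideal that] minus_tableaux_algebra[OF that]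
    by simp
  have "inj ?c"
  proof (rule injI)
    fix c d
    assume "?c c = ?c d"
    then have "Poly_Mapping.single 0 c - Poly_Mapping.single 0 d \<in> max_ideal n m t"
      using coset_eq[OF single_in_tableaux_algebra[OF SSYT_zero] single_in_tableaux_algebra[OF SSYT_zero]]
      by (simp only:)
    from tableau_value_vanishes_on_max_ideal[OF t this] show "c = d"
      using t by (simp add: lin_ext_diff tableau_value_zero)
  qed
  moreover have "max_ideal n m t +>\<^bsub>?R\<^esub> Poly_Mapping.single T 1 = ?c (t T)"
    using coset_eq[OF single_in_tableaux_algebra[OF G_set_SSYT[OF T]] single_in_tableaux_algebra[OF SSYT_zero]]
      column_minus_scalar_in_max_ideal[OF T] by (simp only:)
  ultimately show ?thesis
    using single_in_tableaux_algebra[OF G_set_SSYT[OF T], of "1::'k"] inv_f_f[of ?c "t T"]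
    by (simp add: projection_def)
qed

lemma inj_on_projection:
  assumes "0 < n" "n \<le> m"
  shows "inj_on (projection n m :: (ssyt \<Rightarrow> 'k::field) \<Rightarrow> _) (ordinary_tuples n m)"
proof (rule inj_onI)
  fix t s :: "ssyt \<Rightarrow> 'k"
  assume "t \<in> ordinary_tuples n m" "s \<in> ordinary_tuples n m"
    and eq: "projection n m t = projection n m s"
  then have "respects_relations n m t" "t \<in> extensional (G_set n m)"
      "respects_relations n m s" "s \<in> extensional (G_set n m)"
    by (auto simp: ordinary_tuples_iff[OF assms])
  then show "t = s"
    using eq projection_column by (metis extensionalityI)
qed


section \<open>The group of ordinary tuples and its isomorphic copies\<close>

definition ordinary_group :: "nat \<Rightarrow> nat \<Rightarrow> (ssyt \<Rightarrow> 'k::field) monoid" where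
  "ordinary_group n m =
    \<lparr>carrier = ordinary_tuples n m, mult = tuple_mult n m, one = tuple_one n m\<rparr>"

lemma comm_group_ordinary_group:
  assumes "0 < n" "n \<le> m"
  shows "comm_group (ordinary_group n m :: (ssyt \<Rightarrow> 'k::field) monoid)"
proof (rule comm_groupI)
  let ?H = "ordinary_group n m :: (ssyt \<Rightarrow> 'k) monoid"
  note ord = ordinary_tuples_iff[OF assms]
  have carrier: "carrier ?H = ordinary_tuples n m"
    by (simp add: ordinary_group_def)
  show "t \<otimes>\<^bsub>?H\<^esub> s \<in> carrier ?H" if "t \<in> carrier ?H" "s \<in> carrier ?H" for t s
  proof -
    have "t a * s a * (t b * s b) = t c * s c * (t e * s e)"
      if "{a, b, c, e} \<subseteq> G_set n m" "a + b = c + e" for a b c e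
    proof -
      have eqs: "t a * t b = t c * t e" "s a * s b = s c * s e"
        using \<open>t \<in> carrier ?H\<close> \<open>s \<in> carrier ?H\<close> that
        by (simp_all add: carrier ord respects_relations_def)
      have "t a * s a * (t b * s b) = (t a * t b) * (s a * s b)"
        by (simp add: mult_ac)
      also have "\<dots> = t c * s c * (t e * s e)"
        unfolding eqs by (simp add: mult_ac)
      finally show ?thesis .
    qed
    then show ?thesis
      using that by (auto simp: ordinary_group_def tuple_mult_def ord respects_relations_def)
  qed
  show "\<one>\<^bsub>?H\<^esub> \<in> carrier ?H"
    by (auto simp: ordinary_group_def tuple_one_def ord respects_relations_def)
  show "\<exists>s \<in> carrier ?H. s \<otimes>\<^bsub>?H\<^esub> t = \<one>\<^bsub>?H\<^esub>" if "t \<in> carrier ?H" for t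
  proof
    let ?s = "\<lambda>T \<in> G_set n m. inverse (t T)"
    have "inverse (t a) * inverse (t b) = inverse (t c) * inverse (t e)"
      if "{a, b, c, e} \<subseteq> G_set n m" "a + b = c + e" for a b c e
    proof -
      have "t a * t b = t c * t e"
        using \<open>t \<in> carrier ?H\<close> that by (simp add: carrier ord respects_relations_def)
      then show ?thesis
        by (metis inverse_mult_distrib)
    qed
    then show "?s \<in> carrier ?H"
      using that by (auto simp: carrier ord respects_relations_def)
    show "?s \<otimes>\<^bsub>?H\<^esub> t = \<one>\<^bsub>?H\<^esub>"
      using that by (auto simp: ordinary_group_def tuple_mult_def tuple_one_def ord fun_eq_iff)
  qed
qed (auto simp: ordinary_group_def tuple_mult_def tuple_one_def ordinary_tuples_iff[OF assms]
       mult_ac fun_eq_iff extensional_def)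

text \<open>Injectivity is exactly what makes the operation well defined.\<close>

lemma induced_mult_image:
  assumes "inj_on \<Phi> (ordinary_tuples n m)" "t \<in> ordinary_tuples n m" "s \<in> ordinary_tuples n m"
  shows "induced_mult n m \<Phi> (\<Phi> t) (\<Phi> s) = \<Phi> (tuple_mult n m t s)"
  unfolding induced_mult_def
proof (rule the_equality)
  fix z
  assume "\<exists>t' \<in> ordinary_tuples n m. \<exists>s' \<in> ordinary_tuples n m.
      \<Phi> t = \<Phi> t' \<and> \<Phi> s = \<Phi> s' \<and> z = \<Phi> (tuple_mult n m t' s')"
  then show "z = \<Phi> (tuple_mult n m t s)"
    using assms by (metis inj_onD)
qed (use assms in blast)

text \<open>Transport of structure from the ordinary tuples. \<open>\<Phi>\<close> stands for \<open>max_ideal n m\<close> or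
  \<open>projection n m\<close>.\<close>

lemma induced_group:
  fixes \<Phi> :: "(ssyt \<Rightarrow> 'k::field) \<Rightarrow> 'b"
  assumes "0 < n" "n \<le> m" and inj: "inj_on \<Phi> (ordinary_tuples n m)"
  defines "H \<equiv> \<lparr>carrier = \<Phi> ` ordinary_tuples n m, mult = induced_mult n m \<Phi>,
    one = \<Phi> (tuple_one n m)\<rparr>"
  shows "\<Phi> \<in> iso (ordinary_group n m) H" "comm_group H"
proof -
  interpret comm_group "ordinary_group n m :: (ssyt \<Rightarrow> 'k) monoid"
    by (rule comm_group_ordinary_group[OF assms(1,2)])
  show iso: "\<Phi> \<in> iso (ordinary_group n m) H"
    using inj induced_mult_image[OF inj]
    by (auto simp: iso_def hom_def bij_betw_def H_def ordinary_group_def)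
  have "H\<lparr>one := \<Phi> \<one>\<^bsub>ordinary_group n m\<^esub>\<rparr> = H"
    by (simp add: H_def ordinary_group_def)
  then show "comm_group H"
    using iso_imp_img_comm_group[OF iso] by simp
qed

theorem proposition3p8:
  fixes n m :: nat
  assumes "0 < n" and "n \<le> m"
  shows
    "(\<forall>t \<in> ordinary_tuples n m. \<forall>s \<in> ordinary_tuples n m.
        max_ideal n m t \<otimes>\<^bsub>M_ord_group n m\<^esub> max_ideal n m s
          = (max_ideal n m (tuple_mult n m t s) ::
              (ssyt \<Rightarrow>\<^sub>0 'k::{alg_closed_field, field_char_0}) set))
     \<and> comm_group (M_ord_group n m :: (ssyt \<Rightarrow>\<^sub>0 'k) set monoid)
     \<and> \<one>\<^bsub>M_ord_group n m\<^esub> = (max_ideal n m (tuple_one n m) :: (ssyt \<Rightarrow>\<^sub>0 'k) set)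
     \<and> (\<forall>t \<in> ordinary_tuples n m. \<forall>s \<in> ordinary_tuples n m.
        projection n m t \<otimes>\<^bsub>Pr_0_group n m\<^esub> projection n m s
          = (projection n m (tuple_mult n m t s) :: (ssyt \<Rightarrow>\<^sub>0 'k) \<Rightarrow> 'k))
     \<and> (M_ord_group n m :: (ssyt \<Rightarrow>\<^sub>0 'k) set monoid) \<cong>
         (Pr_0_group n m :: ((ssyt \<Rightarrow>\<^sub>0 'k) \<Rightarrow> 'k) monoid)"
proof -
  let ?O = "ordinary_group n m :: (ssyt \<Rightarrow> 'k) monoid"
  let ?M = "M_ord_group n m :: (ssyt \<Rightarrow>\<^sub>0 'k) set monoid"
  let ?P = "Pr_0_group n m :: ((ssyt \<Rightarrow>\<^sub>0 'k) \<Rightarrow> 'k) monoid"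
  note inj = inj_on_max_ideal[OF assms, where 'k = 'k] inj_on_projection[OF assms, where 'k = 'k]
  have M: "max_ideal n m \<in> iso ?O ?M" "comm_group ?M"
    using induced_group[OF assms inj(1)] by (simp_all add: M_ord_group_def M_ord_def)
  have P: "projection n m \<in> iso ?O ?P"
    using induced_group(1)[OF assms inj(2)] by (simp add: Pr_0_group_def Pr_0_def)
  interpret comm_group ?O
    by (rule comm_group_ordinary_group[OF assms])
  have "?M \<cong> ?O" "?O \<cong> ?P"
    using M(1) P iso_sym is_isoI by blast+
  then have "?M \<cong> ?P"
    by (rule Group.iso_trans)
  then show ?thesis
    using M(2) induced_mult_image[OF inj(1)] induced_mult_image[OF inj(2)]
    by (simp add: M_ord_group_def Pr_0_group_def)
qed

end
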